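(* Let $1/2<\alpha\le1$, $0<\rho<\alpha-1/2$, $C_0>0$ and $c>1$. Then for some $\varepsilon>0$ and $\delta>0$ there is a constant $C>0$ depending on $C_0$ such that every $u:\mathbb{R}^2\to\mathbb{C}$ with $\|u\|_{C^{0,\alpha}(\mathbb{R}^2)}\le C_0$ and $\operatorname{supp}u\subset\{(x,y):y\ge cx^2\}$ satisfies $$\sup_{x}|u(x,\delta)|\le\frac{C}{\left(\log\left(1/\|R[u]\|_{\varepsilon,\delta}\right)\right)^{\rho}}$$ whenever $\|R[u]\|_{\varepsilon,\delta}$ is small. (The right-hand side is read as $0$ when $\|R[u]\|_{\varepsilon,\delta}=0$.)
   Context: Hölder seminorm: $\|u\|_{C^{0,\alpha}(\mathbb{R}^2)}=\sup_{p\ne q}|u(p)-u(q)|/\|p-q\|^\alpha$. Radon transform: $R[u](\xi,\eta)=\int_{\mathbb{R}}u(x,\xi x+\eta)\,dx$. Data norm: for $\varepsilon,\gamma>0$ put $R_{\varepsilon,\gamma}=\{(\xi,\eta):|\xi|\le\varepsilon,|\eta|<\gamma\}$; $\|\cdot\|_{\varepsilon,\gamma}$ is a fixed family of norms, increasing in $\varepsilon$ and $\gamma$, such that for some absolute constant $c'>0$, $\|g\|_{\varepsilon,\gamma}\ge c'\max\{\|g\|_{L^1(R_{\varepsilon,\gamma})},\|g(\cdot,\gamma)\|_{L^1[-\varepsilon,\varepsilon]}\}$; for example $\|g\|_{\varepsilon,\gamma}=\sup_{|\eta|\le\gamma}\|g(\cdot,\eta)\|_{L^1[-\varepsilon,\varepsilon]}$.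 "Small" means below a positive threshold not depending on $u$. *)

theory Defs
  imports "HOL-Analysis.Analysis"
begin

definition holder_seminorm :: "real \<Rightarrow> (real \<times> real \<Rightarrow> complex) \<Rightarrow> ennreal" where
  "holder_seminorm \<alpha> u =
     (SUP (p, q)\<in>{(p, q). p \<noteq> q}. ennreal (norm (u p - u q) / norm (p - q) powr \<alpha>))"

definition radon :: "(real \<times> real \<Rightarrow> complex) \<Rightarrow> real \<times> real \<Rightarrow> complex" where
  "radon u = (\<lambda>(\<xi>, \<eta>). LINT x|lborel. u (x, \<xi> * x + \<eta>))"

definition data_rect :: "real \<Rightarrow> real \<Rightarrow> (real \<times> real) set" where
  "data_rect \<epsilon> \<gamma> = {(\<xi>, \<eta>). \<bar>\<xi>\<bar> \<le> \<epsilon> \<and> \<bar>\<eta>\<bar> < \<gamma>}"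

text \<open>
  The norms take values in \<^typ>\<open>ennreal\<close>: a norm on a space of functions is extended by
  \<open>\<infinity>\<close> to all Borel functions on the plane, so that no domain has to be named.
  Definiteness (modulo null sets of the rectangle) is a consequence of the lower bound.

  The constant \<open>c'\<close> of the lower bound does not depend on \<open>g\<close>, \<open>\<epsilon>\<close>, \<open>\<gamma>\<close>, as long as these
  parameters stay in a bounded range \<open>(0, M]\<close>. Uniformity over all \<open>\<gamma> > 0\<close> would be a
  stronger requirement, and one that the standard example \<open>slice_sup_norm\<close> below violates:
  for \<open>g = 1\<close> the ratio of that norm to the \<open>L\<^sup>1\<close> norm on the rectangle is \<open>1 / (2 * \<gamma>)\<close>.
\<close>

definition data_norm_family ::
    "(real \<Rightarrow> real \<Rightarrow> (real \<times> real \<Rightarrow> complex) \<Rightarrow> ennreal) \<Rightarrow> bool" where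
  "data_norm_family N \<longleftrightarrow>
     (\<forall>\<epsilon>>0. \<forall>\<gamma>>0. \<forall>g\<in>borel_measurable borel. \<forall>a.
        N \<epsilon> \<gamma> (\<lambda>p. a * g p) = ennreal (norm a) * N \<epsilon> \<gamma> g) \<and>
     (\<forall>\<epsilon>>0. \<forall>\<gamma>>0. \<forall>g\<in>borel_measurable borel. \<forall>h\<in>borel_measurable borel.
        N \<epsilon> \<gamma> (\<lambda>p. g p + h p) \<le> N \<epsilon> \<gamma> g + N \<epsilon> \<gamma> h) \<and>
     (\<forall>\<epsilon>>0. \<forall>\<gamma>>0. \<forall>\<epsilon>'\<ge>\<epsilon>. \<forall>\<gamma>'\<ge>\<gamma>. \<forall>g\<in>borel_measurable borel.
        N \<epsilon> \<gamma> g \<le> N \<epsilon>' \<gamma>' g) \<and>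
     (\<forall>M>0. \<exists>c'>0. \<forall>\<epsilon>\<in>{0<..M}. \<forall>\<gamma>\<in>{0<..M}. \<forall>g\<in>borel_measurable borel.
        ennreal c' *
          max (\<integral>\<^sup>+p\<in>data_rect \<epsilon> \<gamma>. ennreal (norm (g p)) \<partial>lborel)
              (\<integral>\<^sup>+\<xi>\<in>{-\<epsilon>..\<epsilon>}. ennreal (norm (g (\<xi>, \<gamma>))) \<partial>lborel)
        \<le> N \<epsilon> \<gamma> g)"

definition slice_sup_norm ::
    "real \<Rightarrow> real \<Rightarrow> (real \<times> real \<Rightarrow> complex) \<Rightarrow> ennreal" where
  "slice_sup_norm \<epsilon> \<gamma> g =
     (SUP \<eta>\<in>{-\<gamma>..\<gamma>}. \<integral>\<^sup>+\<xi>\<in>{-\<epsilon>..\<epsilon>}. ennreal (norm (g (\<xi>, \<eta>))) \<partial>lborel)"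

lemma slice_sup_norm_data_norm_family: "data_norm_family slice_sup_norm"
proof -
  have m1[measurable]: "(\<lambda>\<xi>. g (\<xi>, \<eta>)) \<in> borel_measurable borel"
    if [measurable]: "g \<in> borel_measurable borel"
    for g :: "real \<times> real \<Rightarrow> complex" and \<eta>
    by (rule measurable_compose[OF _ that]) (simp add: borel_prod[symmetric])
  have hom: "slice_sup_norm \<epsilon> \<gamma> (\<lambda>p. a * g p) = ennreal (norm a) * slice_sup_norm \<epsilon> \<gamma> g"
    if [measurable]: "g \<in> borel_measurable borel" for \<epsilon> \<gamma> a g
    unfolding slice_sup_norm_def SUP_mult_left_ennreal
    by (simp add: norm_mult ennreal_mult mult.assoc nn_integral_cmult)
  have tri: "slice_sup_norm \<epsilon> \<gamma> (\<lambda>p. g p + h p) \<le> slice_sup_norm \<epsilon> \<gamma> g + slice_sup_norm \<epsilon> \<gamma> h"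
    if [measurable]: "g \<in> borel_measurable borel" "h \<in> borel_measurable borel" for \<epsilon> \<gamma> g h
    unfolding slice_sup_norm_def
  proof (rule SUP_least)
    fix \<eta> assume \<eta>: "\<eta> \<in> {-\<gamma>..\<gamma>}"
    have "(\<integral>\<^sup>+\<xi>\<in>{-\<epsilon>..\<epsilon>}. ennreal (norm (g (\<xi>, \<eta>) + h (\<xi>, \<eta>))) \<partial>lborel)
        \<le> (\<integral>\<^sup>+\<xi>. ennreal (norm (g (\<xi>, \<eta>))) * indicator {-\<epsilon>..\<epsilon>} \<xi>
              + ennreal (norm (h (\<xi>, \<eta>))) * indicator {-\<epsilon>..\<epsilon>} \<xi> \<partial>lborel)"
      by (intro nn_integral_mono)
        (auto simp: indicator_def norm_triangle_ineq simp flip: ennreal_plus)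
    also have "\<dots> = (\<integral>\<^sup>+\<xi>\<in>{-\<epsilon>..\<epsilon>}. ennreal (norm (g (\<xi>, \<eta>))) \<partial>lborel)
        + (\<integral>\<^sup>+\<xi>\<in>{-\<epsilon>..\<epsilon>}. ennreal (norm (h (\<xi>, \<eta>))) \<partial>lborel)"
      by (rule nn_integral_add) auto
    also have "\<dots> \<le> (SUP \<eta>\<in>{-\<gamma>..\<gamma>}. \<integral>\<^sup>+\<xi>\<in>{-\<epsilon>..\<epsilon>}. ennreal (norm (g (\<xi>, \<eta>))) \<partial>lborel)
        + (SUP \<eta>\<in>{-\<gamma>..\<gamma>}. \<integral>\<^sup>+\<xi>\<in>{-\<epsilon>..\<epsilon>}. ennreal (norm (h (\<xi>, \<eta>))) \<partial>lborel)"
      by (intro add_mono SUP_upper \<eta>)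
    finally show "(\<integral>\<^sup>+\<xi>\<in>{-\<epsilon>..\<epsilon>}. ennreal (norm (g (\<xi>, \<eta>) + h (\<xi>, \<eta>))) \<partial>lborel) \<le> \<dots>" .
  qed
  have mono: "slice_sup_norm \<epsilon> \<gamma> g \<le> slice_sup_norm \<epsilon>' \<gamma>' g"
    if "\<epsilon> \<le> \<epsilon>'" "\<gamma> \<le> \<gamma>'" for \<epsilon> \<gamma> \<epsilon>' \<gamma>' g
    unfolding slice_sup_norm_def using that
    by (intro SUP_subset_mono nn_integral_mono) (auto simp: indicator_def)
  have low2: "(\<integral>\<^sup>+\<xi>\<in>{-\<epsilon>..\<epsilon>}. ennreal (norm (g (\<xi>, \<gamma>))) \<partial>lborel) \<le> slice_sup_norm \<epsilon> \<gamma> g"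
    if "\<gamma> > 0" for \<epsilon> \<gamma> g
    unfolding slice_sup_norm_def by (rule SUP_upper) (use that in auto)
  have low1: "(\<integral>\<^sup>+p\<in>data_rect \<epsilon> \<gamma>. ennreal (norm (g p)) \<partial>lborel)
      \<le> ennreal (2 * \<gamma>) * slice_sup_norm \<epsilon> \<gamma> g"
    if [measurable]: "g \<in> borel_measurable borel" and "\<gamma> > 0" for \<epsilon> \<gamma> g
  proof -
    have [measurable]: "g \<in> borel_measurable (lborel \<Otimes>\<^sub>M lborel)"
      unfolding lborel_prod using that by simp
    have "(\<integral>\<^sup>+p\<in>data_rect \<epsilon> \<gamma>. ennreal (norm (g p)) \<partial>lborel)
      \<le> (\<integral>\<^sup>+p. ennreal (norm (g p)) * indicator {-\<epsilon>..\<epsilon>} (fst p) * indicator {-\<gamma>..\<gamma>} (snd p)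
            \<partial>(lborel \<Otimes>\<^sub>M lborel))"
      unfolding lborel_prod
      by (intro nn_integral_mono) (auto simp: data_rect_def indicator_def)
    also have "\<dots> = (\<integral>\<^sup>+\<eta>. \<integral>\<^sup>+\<xi>. ennreal (norm (g (\<xi>, \<eta>))) * indicator {-\<epsilon>..\<epsilon>} \<xi>
         * indicator {-\<gamma>..\<gamma>} \<eta> \<partial>lborel \<partial>lborel)"
      by (subst lborel_pair.nn_integral_snd[symmetric]) (simp_all add: split_beta')
    also have "\<dots> \<le> (\<integral>\<^sup>+\<eta>. slice_sup_norm \<epsilon> \<gamma> g * indicator {-\<gamma>..\<gamma>} \<eta> \<partial>lborel)"
      unfolding slice_sup_norm_def
      by (intro nn_integral_mono) (auto simp: indicator_def intro!: SUP_upper2)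
    also have "\<dots> = ennreal (2 * \<gamma>) * slice_sup_norm \<epsilon> \<gamma> g"
      using that by (simp add: nn_integral_cmult_indicator mult.commute)
    finally show ?thesis .
  qed
  have low: "\<exists>c'>0. \<forall>\<epsilon>\<in>{0<..M}. \<forall>\<gamma>\<in>{0<..M}. \<forall>g\<in>borel_measurable borel.
        ennreal c' *
          max (\<integral>\<^sup>+p\<in>data_rect \<epsilon> \<gamma>. ennreal (norm (g p)) \<partial>lborel)
              (\<integral>\<^sup>+\<xi>\<in>{-\<epsilon>..\<epsilon>}. ennreal (norm (g (\<xi>, \<gamma>))) \<partial>lborel)
        \<le> slice_sup_norm \<epsilon> \<gamma> g" if "M > 0" for M
  proof (intro exI conjI ballI)
    show "1 / (2 * M + 1) > 0" using that by simp
    fix \<epsilon> \<gamma> :: real and g :: "real \<times> real \<Rightarrow> complex"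
    assume *: "\<epsilon> \<in> {0<..M}" "\<gamma> \<in> {0<..M}" "g \<in> borel_measurable borel"
    let ?S = "slice_sup_norm \<epsilon> \<gamma> g"
    have "(\<integral>\<^sup>+p\<in>data_rect \<epsilon> \<gamma>. ennreal (norm (g p)) \<partial>lborel) \<le> ennreal (2 * \<gamma>) * ?S"
      using low1[where g = g and \<gamma> = \<gamma> and \<epsilon> = \<epsilon>] * by simp
    also have "\<dots> \<le> ennreal (2 * M + 1) * ?S"
      using * by (intro mult_right_mono ennreal_leI) auto
    finally have a: "(\<integral>\<^sup>+p\<in>data_rect \<epsilon> \<gamma>. ennreal (norm (g p)) \<partial>lborel)
        \<le> ennreal (2 * M + 1) * ?S" .
    have "(\<integral>\<^sup>+\<xi>\<in>{-\<epsilon>..\<epsilon>}. ennreal (norm (g (\<xi>, \<gamma>))) \<partial>lborel) \<le> 1 * ?S"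
      using low2[where g = g and \<gamma> = \<gamma> and \<epsilon> = \<epsilon>] * by simp
    also have "\<dots> \<le> ennreal (2 * M + 1) * ?S"
      using that ennreal_leI[of 1 "2 * M + 1"] by (intro mult_right_mono) auto
    finally have b: "(\<integral>\<^sup>+\<xi>\<in>{-\<epsilon>..\<epsilon>}. ennreal (norm (g (\<xi>, \<gamma>))) \<partial>lborel)
        \<le> ennreal (2 * M + 1) * ?S" .
    have "ennreal (1 / (2 * M + 1)) *
          max (\<integral>\<^sup>+p\<in>data_rect \<epsilon> \<gamma>. ennreal (norm (g p)) \<partial>lborel)
              (\<integral>\<^sup>+\<xi>\<in>{-\<epsilon>..\<epsilon>}. ennreal (norm (g (\<xi>, \<gamma>))) \<partial>lborel)
        \<le> ennreal (1 / (2 * M + 1)) * (ennreal (2 * M + 1) * ?S)"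
      using a b by (intro mult_left_mono) auto
    also have "\<dots> = ?S"
      using that by (simp add: mult.assoc[symmetric] ennreal_mult[symmetric] del: ennreal_plus)
    finally show "ennreal (1 / (2 * M + 1)) *
          max (\<integral>\<^sup>+p\<in>data_rect \<epsilon> \<gamma>. ennreal (norm (g p)) \<partial>lborel)
              (\<integral>\<^sup>+\<xi>\<in>{-\<epsilon>..\<epsilon>}. ennreal (norm (g (\<xi>, \<gamma>))) \<partial>lborel) \<le> ?S" .
  qed
  show ?thesis
    unfolding data_norm_family_def
    by (intro conjI allI ballI impI) (auto intro!: hom tri mono low)
qed

end

theory Submission
  imports Defs "HOL-Real_Asymp.Real_Asymp"
begin

text \<open>
  The proof takes \<open>\<epsilon> = 1/4\<close> and \<open>\<delta> = 1/16\<close> and tests the data against explicit weights. Since \<open>u\<close>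
  is supported above the parabola \<open>y = x\<^sup>2\<close>, lines with \<open>\<bar>\<xi>\<bar> \<le> 1/4\<close> and \<open>\<eta> \<le> -1/16\<close> carry no
  information, and integrals in \<open>\<eta>\<close> may start at \<open>-1/16\<close> and stop at the edge \<open>1/16\<close> of the data.

  On functions of \<open>\<xi> * x + \<eta>\<close> multiplication by \<open>x\<close> intertwines \<open>\<partial>/\<partial>\<eta>\<close> with \<open>\<partial>/\<partial>\<xi>\<close>. The moment
  \<open>\<integral> x\<^sup>k u (x, \<xi> * x + \<eta>) dx\<close> is therefore the \<open>k\<close>-th derivative in \<open>\<xi>\<close> of the \<open>k\<close>-fold primitive in \<open>\<eta>\<close>
  of the Radon transform. Averaged against a smooth weight in \<open>\<xi>\<close>, the derivatives fall on the
  weight; averaged against a tent just below \<open>\<eta> = 1/16\<close>, the primitives fall on the tent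
  (\<open>pairing_times_x\<close>). So the \<open>k\<close>-th moment is bounded by the \<open>L\<^sup>1\<close> norm \<open>m\<close> of the data times
  \<open>2 * (2 * M) ^ k\<close>, if the weight in \<open>\<xi>\<close> is \<open>(1/16 - \<xi>\<^sup>2) ^ M\<close> with \<open>M \<ge> k\<close> (\<open>pairing_monomial_bound\<close>).

  Now take the Landau kernel \<open>(1 - (x - x\<^sub>0)\<^sup>2) ^ n\<close> as a polynomial in \<open>x\<close>, the kernel
  \<open>(1/16 - \<xi>\<^sup>2) ^ (2 * n)\<close> as weight in \<open>\<xi>\<close>, and a tent of width \<open>1 / (8 * n)\<close> in \<open>\<eta>\<close>. Their product
  concentrates near \<open>(x\<^sub>0, 0, 1/16)\<close> at scale \<open>1 / sqrt n\<close>, so for \<open>u\<close> in the Hoelder class the pairing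
  gives \<open>u (x\<^sub>0, 1/16)\<close> with an error \<open>O (n powr (- \<alpha>/2))\<close> (\<open>averaging\<close>). Together
  \<open>\<bar>u (x\<^sub>0, 1/16)\<bar> \<le> 4096 * (400 * n) ^ (2 * n) * m + 4 * C\<^sub>0 * n powr (- \<alpha>/2)\<close> for every \<open>n > 0\<close>
  (\<open>point_bound\<close>). If \<open>\<mu>\<close> is the data norm, which dominates a multiple of \<open>m\<close>, then choosing
  \<open>n\<close> of order \<open>ln (1 / \<mu>) powr (2 * \<rho> / \<alpha>)\<close> gives the logarithmic rate \<open>\<rho>\<close> whenever
  \<open>\<rho> < \<alpha>/2\<close> (\<open>log_rate\<close>), and \<open>\<alpha> - 1/2 \<le> \<alpha>/2\<close> because \<open>\<alpha> \<le> 1\<close>.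
\<close>

section \<open>Iterated primitives of a tent\<close>

definition ramp :: "nat \<Rightarrow> real \<Rightarrow> real" where
  "ramp j t = max 0 t ^ Suc j / fact (Suc j)"

lemma continuous_on_ramp [continuous_intros]:
  "continuous_on S f \<Longrightarrow> continuous_on S (\<lambda>x. ramp j (f x))"
  unfolding ramp_def by (intro continuous_intros) auto

lemma ramp_bounds: "t \<le> 1 \<Longrightarrow> 0 \<le> ramp j t \<and> ramp j t \<le> 1"
proof -
  assume "t \<le> 1"
  then have "0 \<le> max 0 t ^ Suc j" "max 0 t ^ Suc j \<le> 1" by (auto intro!: power_le_one simp del: power_Suc)
  moreover have "(1::real) \<le> fact (Suc j)" by (rule fact_ge_1)
  ultimately have "max 0 t ^ Suc j \<le> fact (Suc j)" by linarith
  then show ?thesis unfolding ramp_def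
    by (auto simp: divide_simps simp del: fact_Suc power_Suc)
qed

lemma DERIV_ramp:
  "((\<lambda>t. ramp (Suc j) t) has_real_derivative ramp j t) (at t)"
proof -
  consider "t < 0" | "t > 0" | "t = 0" by linarith
  then show ?thesis
  proof cases
    case 1
    have "((\<lambda>t::real. 0::real) has_real_derivative 0) (at t)" by simp
    then have "((\<lambda>t. ramp (Suc j) t) has_real_derivative 0) (at t)"
      by (rule has_field_derivative_transform_within_open[where S = "{..<0}"])
        (use 1 in \<open>auto simp: ramp_def\<close>)
    then show ?thesis using 1 by (simp add: ramp_def)
  next
    case 2
    have "((\<lambda>t::real. t ^ Suc (Suc j) / fact (Suc (Suc j))) has_real_derivative
        real (Suc (Suc j)) * t ^ Suc j / fact (Suc (Suc j))) (at t)"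
      by (rule derivative_eq_intros refl | simp)+
    then have "((\<lambda>t. ramp (Suc j) t) has_real_derivative
        real (Suc (Suc j)) * t ^ Suc j / fact (Suc (Suc j))) (at t)"
      by (rule has_field_derivative_transform_within_open[where S = "{0<..}"])
        (use 2 in \<open>auto simp: ramp_def\<close>)
    moreover have "real (Suc (Suc j)) * t ^ Suc j / fact (Suc (Suc j)) = ramp j t"
      unfolding ramp_def fact_Suc[of "Suc j"] using 2 by (simp del: fact_Suc of_nat_Suc power_Suc)
    ultimately show ?thesis by simp
  next
    case 3
    have "((\<lambda>h. ramp (Suc j) h / h) \<longlongrightarrow> 0) (at 0)"
    proof (rule Lim_null_comparison)
      show "\<forall>\<^sub>F h in at 0. norm (ramp (Suc j) h / h) \<le> \<bar>h\<bar> ^ Suc j"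
      proof (rule eventually_at_filter[THEN iffD2], rule always_eventually, intro allI impI)
        fix h :: real assume "h \<noteq> 0"
        have "(1::real) \<le> fact (Suc (Suc j))" by (rule fact_ge_1)
        then have "\<bar>ramp (Suc j) h\<bar> \<le> \<bar>h\<bar> ^ Suc (Suc j) / 1"
          unfolding ramp_def abs_divide power_abs
          using power_mono[of "max 0 h" "\<bar>h\<bar>" "Suc (Suc j)"]
          by (intro frac_le) (auto simp del: fact_Suc power_Suc)
        then show "norm (ramp (Suc j) h / h) \<le> \<bar>h\<bar> ^ Suc j"
          using \<open>h \<noteq> 0\<close> by (simp add: divide_simps mult.commute)
      qed
      have "((\<lambda>h::real. \<bar>h\<bar> ^ Suc j) \<longlongrightarrow> \<bar>0\<bar> ^ Suc j) (at 0)" by (intro tendsto_intros)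
      then show "((\<lambda>h::real. \<bar>h\<bar> ^ Suc j) \<longlongrightarrow> 0) (at 0)" by simp
    qed
    then show ?thesis using 3 by (simp add: has_field_derivative_iff ramp_def)
  qed
qed

text \<open>
  For \<open>j = 0\<close> this is a tent of width \<open>s\<close> whose right foot is \<open>\<eta> = 1/16\<close>; raising \<open>j\<close> by one
  integrates once more from the right. All of them vanish beyond \<open>1/16\<close>, so that they
  can be paired with data known only for \<open>\<eta> < 1/16\<close>. The truncated powers have explicit bounds
  in every order, which is why the tent is written as their second difference.
\<close>
definition tent :: "real \<Rightarrow> nat \<Rightarrow> real \<Rightarrow> real" where
  "tent s j \<eta> = ramp j (1/16 - \<eta>) - 2 * ramp j (1/16 - s/2 - \<eta>) + ramp j (1/16 - s - \<eta>)"

lemma continuous_on_tent [continuous_intros]: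
  "continuous_on S f \<Longrightarrow> continuous_on S (\<lambda>x. tent s j (f x))"
  unfolding tent_def by (intro continuous_intros)

lemma tent_bound:
  assumes "s > 0" "\<eta> \<ge> -1/16" shows "\<bar>tent s j \<eta>\<bar> \<le> 2"
  using ramp_bounds[of "1/16 - \<eta>" j] ramp_bounds[of "1/16 - s/2 - \<eta>" j]
    ramp_bounds[of "1/16 - s - \<eta>" j] assms unfolding tent_def by (auto simp: abs_le_iff)

lemma tent_eq_0: "s > 0 \<Longrightarrow> \<eta> \<ge> 1/16 \<Longrightarrow> tent s j \<eta> = 0"
  by (simp add: tent_def ramp_def)

lemma tent_0_nonneg: "s > 0 \<Longrightarrow> tent s 0 \<eta> \<ge> 0"
  by (simp add: tent_def ramp_def max_def)

lemma tent_0_eq_0: "s > 0 \<Longrightarrow> \<eta> \<le> 1/16 - s \<Longrightarrow> tent s 0 \<eta> = 0"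
  by (simp add: tent_def ramp_def max_def)

lemma DERIV_tent:
  assumes "(f has_real_derivative f') (at x)"
  shows "((\<lambda>x. tent s (Suc j) (f x)) has_real_derivative - tent s j (f x) * f') (at x)"
  unfolding tent_def
  by (rule derivative_eq_intros DERIV_chain2[OF DERIV_ramp] assms refl | simp add: algebra_simps)+

lemma integral_tent_0:
  assumes "0 < s" "s \<le> 1/8"
  shows "integral {-1/16..1/16} (tent s 0) = s\<^sup>2 / 4"
proof -
  have "(tent s 0 has_integral (- tent s 1 (1/16)) - (- tent s 1 (-1/16))) {-1/16..1/16}"
  proof (rule fundamental_theorem_of_calculus)
    show "((\<lambda>x. - tent s 1 x) has_vector_derivative tent s 0 x) (at x within {-1/16..1/16})" for x
      using DERIV_minus[OF DERIV_tent[OF DERIV_ident, of s 0 x]]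
      by (simp add: has_real_derivative_iff_has_vector_derivative[symmetric] has_field_derivative_at_within)
  qed simp
  moreover have "(- tent s 1 (1/16)) - (- tent s 1 (-1/16)) = s\<^sup>2 / 4"
    using assms by (simp add: tent_def ramp_def max_def field_simps power2_eq_square)
  ultimately show ?thesis by (metis integral_unique)
qed

section \<open>Averaging weights in the slope\<close>

text \<open>
  The Landau kernel \<open>(1/16 - \<xi>\<^sup>2)\<^sup>M\<close> is the case \<open>a = b = M\<close>. Two independent exponents make the
  family closed under differentiation, so no higher derivatives have to be written down, and
  the boundary terms of an integration by parts vanish as long as both exponents are positive.
\<close>
definition bump :: "nat \<Rightarrow> nat \<Rightarrow> real \<Rightarrow> real" where
  "bump a b \<xi> = (1/4 - \<xi>) ^ a * (1/4 + \<xi>) ^ b"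

lemma continuous_on_bump [continuous_intros]:
  "continuous_on S f \<Longrightarrow> continuous_on S (\<lambda>x. bump a b (f x))"
  unfolding bump_def by (intro continuous_intros)

lemma bump_bounds: assumes "\<xi> \<in> {-1/4..1/4}" shows "0 \<le> bump a b \<xi>" "bump a b \<xi> \<le> 1"
  using assms unfolding bump_def by (auto intro!: mult_nonneg_nonneg mult_le_one power_le_one)

lemma bump_ends: "bump (Suc a) b (1/4) = 0" "bump a (Suc b) (-1/4) = 0" "bump a (Suc b) (- (1/4)) = 0"
  by (simp_all add: bump_def)

lemma DERIV_bump:
  "(bump (Suc a) (Suc b) has_real_derivative
     (- real (Suc a) * bump a (Suc b) \<xi> + real (Suc b) * bump (Suc a) b \<xi>)) (at \<xi>)"
proof -
  have "((\<lambda>\<xi>. (1/4 - \<xi>) ^ Suc a) has_real_derivative - (real (Suc a) * (1/4 - \<xi>) ^ a)) (at \<xi>)"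
    "((\<lambda>\<xi>. (1/4 + \<xi>) ^ Suc b) has_real_derivative real (Suc b) * (1/4 + \<xi>) ^ b) (at \<xi>)"
    by (rule derivative_eq_intros refl | simp)+
  from DERIV_mult[OF this] show ?thesis
    unfolding bump_def[abs_def] by (rule DERIV_cong) (simp add: mult_ac del: power_Suc of_nat_Suc)
qed

section \<open>Concentration of Landau kernels\<close>

lemma integral_box_prod:
  fixes f g h :: "real \<Rightarrow> real"
  assumes f: "continuous_on UNIV f" and g: "continuous_on UNIV g" and h: "continuous_on UNIV h"
  shows "((\<lambda>(x, \<xi>, \<eta>). f x * g \<xi> * h \<eta>) has_integral
      integral {a..a'} f * integral {b..b'} g * integral {d..d'} h) (cbox (a, b, d) (a', b', d'))"
proof -
  note c [continuous_intros] = continuous_on_compose2[OF f] continuous_on_compose2[OF g]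
    continuous_on_compose2[OF h]
  have cont: "continuous_on S (\<lambda>(x, \<xi>, \<eta>). f x * g \<xi> * h \<eta>)" for S
    unfolding split_beta' by (intro continuous_intros) auto
  have "integral (cbox (a, b, d) (a', b', d')) (\<lambda>(x, \<xi>, \<eta>). f x * g \<xi> * h \<eta>)
     = integral {a..a'} (\<lambda>x. integral {b..b'} (\<lambda>\<xi>. integral {d..d'} (\<lambda>\<eta>. f x * g \<xi> * h \<eta>)))"
    by (subst integral_prod_continuous, rule cont, subst integral_prod_continuous)
      (auto simp: split_beta' intro!: continuous_intros)
  also have "\<dots> = integral {a..a'} f * integral {b..b'} g * integral {d..d'} h"
    by (simp add: mult.assoc)
  finally show ?thesis
    using integrable_integral[OF integrable_continuous[OF cont]] by metis
qed

text \<open>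
  The derivative of \<open>t * (b\<^sup>2 - t\<^sup>2)\<^bsup>n+1\<^esup>\<close> is \<open>b\<^sup>2 * W - (2 * n + 3) * t\<^sup>2 * W\<close> with
  \<open>W = (b\<^sup>2 - t\<^sup>2)\<^sup>n\<close>, and its integral over an interval around \<open>0\<close> inside \<open>[-b, b]\<close> is
  nonnegative. So the kernel has width of order \<open>b / sqrt n\<close>, even on an asymmetric interval.
\<close>
lemma landau_second_moment:
  fixes x\<^sub>0 b l r :: real
  assumes "x\<^sub>0 - b \<le> l" "l \<le> x\<^sub>0" "x\<^sub>0 \<le> r" "r \<le> x\<^sub>0 + b"
  shows "(2 * real n + 3) * integral {l..r} (\<lambda>x. (x - x\<^sub>0)\<^sup>2 * (b\<^sup>2 - (x - x\<^sub>0)\<^sup>2) ^ n)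
     \<le> b\<^sup>2 * integral {l..r} (\<lambda>x. (b\<^sup>2 - (x - x\<^sub>0)\<^sup>2) ^ n)"
proof -
  let ?W = "\<lambda>x. (b\<^sup>2 - (x - x\<^sub>0)\<^sup>2) ^ n" and ?G = "\<lambda>x. (x - x\<^sub>0) * (b\<^sup>2 - (x - x\<^sub>0)\<^sup>2) ^ Suc n"
  have "((\<lambda>x. b\<^sup>2 * ?W x - (2 * real n + 3) * ((x - x\<^sub>0)\<^sup>2 * ?W x)) has_integral ?G r - ?G l) {l..r}"
  proof (rule fundamental_theorem_of_calculus)
    fix x
    have "((\<lambda>x. (b\<^sup>2 - (x - x\<^sub>0)\<^sup>2) ^ Suc n) has_real_derivative
       real (Suc n) * ?W x * - (2 * (x - x\<^sub>0))) (at x)"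
      by (rule derivative_eq_intros refl | simp)+
    from DERIV_mult[OF DERIV_diff[OF DERIV_ident DERIV_const] this, of x\<^sub>0]
    have "(?G has_real_derivative b\<^sup>2 * ?W x - (2 * real n + 3) * ((x - x\<^sub>0)\<^sup>2 * ?W x)) (at x)"
      by (rule DERIV_cong) (simp add: algebra_simps power2_eq_square)
    then show "(?G has_vector_derivative b\<^sup>2 * ?W x - (2 * real n + 3) * ((x - x\<^sub>0)\<^sup>2 * ?W x)) (at x within {l..r})"
      by (simp only: has_real_derivative_iff_has_vector_derivative[symmetric] has_field_derivative_at_within)
  qed (use assms in auto)
  moreover have "((\<lambda>x. b\<^sup>2 * ?W x - (2 * real n + 3) * ((x - x\<^sub>0)\<^sup>2 * ?W x)) has_integral
     b\<^sup>2 * integral {l..r} ?W - (2 * real n + 3) * integral {l..r} (\<lambda>x. (x - x\<^sub>0)\<^sup>2 * ?W x)) {l..r}"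
    by (intro has_integral_diff has_integral_mult_right integrable_integral
      integrable_continuous_real continuous_intros)
  ultimately have "b\<^sup>2 * integral {l..r} ?W - (2 * real n + 3) * integral {l..r} (\<lambda>x. (x - x\<^sub>0)\<^sup>2 * ?W x)
     = ?G r - ?G l" by (rule has_integral_unique[symmetric])
  moreover have "?G r \<ge> 0" "?G l \<le> 0"
  proof -
    have "\<bar>r - x\<^sub>0\<bar> \<le> \<bar>b\<bar>" "\<bar>l - x\<^sub>0\<bar> \<le> \<bar>b\<bar>" using assms by auto
    then have "b\<^sup>2 - (r - x\<^sub>0)\<^sup>2 \<ge> 0" "b\<^sup>2 - (l - x\<^sub>0)\<^sup>2 \<ge> 0"
      by (simp_all add: abs_le_square_iff)
    then show "?G r \<ge> 0" "?G l \<le> 0" using assms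
      by (auto intro!: mult_nonneg_nonneg mult_nonpos_nonneg zero_le_power simp del: power_Suc)
  qed
  ultimately show ?thesis by linarith
qed

lemma integral_ge_width:
  fixes f :: "real \<Rightarrow> real"
  assumes "continuous_on {l..r} f" "l \<le> p" "p \<le> q" "q \<le> r"
    and "\<And>x. x \<in> {l..r} \<Longrightarrow> f x \<ge> 0" "\<And>x. x \<in> {p..q} \<Longrightarrow> f x \<ge> w"
  shows "(q - p) * w \<le> integral {l..r} f"
proof -
  have sub: "{p..q} \<subseteq> {l..r}" using assms by auto
  have i: "f integrable_on {l..r}" "f integrable_on {p..q}"
    by (intro integrable_continuous_real continuous_on_subset[OF assms(1)] sub order.refl)+
  have "(q - p) * w = integral {p..q} (\<lambda>_. w)" using assms by simp
  also have "\<dots> \<le> integral {p..q} f" by (intro integral_le i assms) auto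
  also have "\<dots> \<le> integral {l..r} f" by (intro integral_subset_le sub i ballI assms)
  finally show ?thesis .
qed

text \<open>
  A Hoelder modulus at distance \<open>d\<close> is dominated by its value at the scale \<open>1 / sqrt n\<close> times a
  quadratic factor; thus second moments of the kernels are all that an averaging estimate needs.
\<close>
lemma powr_le_rescaled_square:
  fixes d \<alpha> :: real
  assumes "d \<ge> 0" "n > 0" "0 < \<alpha>" "\<alpha> \<le> 1"
  shows "d powr \<alpha> \<le> real n powr (- \<alpha>/2) * (1 + real n * d\<^sup>2)"
proof -
  let ?t = "real n * d\<^sup>2"
  have t: "?t powr (\<alpha>/2) \<le> 1 + ?t"
  proof (cases "?t \<le> 1")
    case True
    then have "?t powr (\<alpha>/2) \<le> 1" using assms by (intro powr_le1) auto
    then show ?thesis using assms by (smt (verit) mult_nonneg_nonneg of_nat_0_le_iff zero_le_power2)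
  next
    case False
    then have "?t powr (\<alpha>/2) \<le> ?t powr 1" using assms by (intro powr_mono) auto
    then show ?thesis using False by simp
  qed
  have "d powr \<alpha> = real n powr (- \<alpha>/2) * ?t powr (\<alpha>/2)"
  proof (cases "d = 0")
    case False
    then have "(d\<^sup>2) powr (\<alpha>/2) = d powr \<alpha>"
      using assms powr_powr[of d 2 "\<alpha>/2"] by simp
    then show ?thesis using assms False by (simp add: powr_mult powr_minus)
  qed simp
  also have "\<dots> \<le> real n powr (- \<alpha>/2) * (1 + ?t)" by (intro mult_left_mono t) auto
  finally show ?thesis .
qed

section \<open>Pairing a function with product weights along lines\<close>

locale parabola_supported =
  fixes u :: "real \<times> real \<Rightarrow> complex"
  assumes continuous: "continuous_on UNIV u"
    and support: "\<And>x y. y < x\<^sup>2 \<Longrightarrow> u (x, y) = 0"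
begin

lemma continuous_on_comp [continuous_intros]:
  "continuous_on S f \<Longrightarrow> continuous_on S (\<lambda>x. u (f x))"
  by (rule continuous_on_compose2[OF continuous]) auto

text \<open>
  Lines of slope at most \<open>1/4\<close> miss the parabola \<open>y = x\<^sup>2\<close> when their intercept is at most \<open>-1/16\<close>,
  and lie below it outside \<open>[-1/2, 1/2]\<close> when the intercept is at most \<open>1/16\<close>. These two facts fix
  the box over which everything is integrated.
\<close>
lemma vanishes_low:
  assumes "\<bar>\<xi>\<bar> \<le> 1/4" "\<eta> \<le> -1/16" shows "u (x, \<xi> * x + \<eta>) = 0"
proof (rule support)
  have "\<bar>\<xi> * x\<bar> \<le> 1/4 * \<bar>x\<bar>" unfolding abs_mult using assms by (intro mult_right_mono) auto
  moreover have "(\<bar>x\<bar> - 1/8)\<^sup>2 \<ge> 0" by simp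
  ultimately show "\<xi> * x + \<eta> < x\<^sup>2" using assms by (simp add: power2_diff power_divide)
qed

lemma vanishes_wide:
  assumes "\<bar>\<xi>\<bar> \<le> 1/4" "\<eta> \<le> 1/16" "\<bar>x\<bar> > 1/2" shows "u (x, \<xi> * x + \<eta>) = 0"
proof (rule support)
  have "\<bar>\<xi> * x\<bar> \<le> 1/4 * \<bar>x\<bar>" unfolding abs_mult using assms by (intro mult_right_mono) auto
  moreover have "1/2 * \<bar>x\<bar> \<le> \<bar>x\<bar> * \<bar>x\<bar>" using assms by (intro mult_right_mono) auto
  ultimately show "\<xi> * x + \<eta> < x\<^sup>2" using assms by (simp add: power2_eq_square)
qed

text \<open>
  For \<open>g = 1\<close> the integral over \<open>x\<close> is the Radon transform, so the pairing is controlled by the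
  data. For Landau kernels \<open>g\<close> and \<open>A\<close> and a tent \<open>B\<close> it is, up to normalisation, an average of \<open>u\<close>
  near one point of the line \<open>y = 1/16\<close>.
\<close>
definition pairing :: "(real \<Rightarrow> real) \<Rightarrow> (real \<Rightarrow> real) \<Rightarrow> (real \<Rightarrow> real) \<Rightarrow> complex" where
  "pairing g A B = integral (cbox (-1/2, -1/4, -1/16) (1/2, 1/4, 1/16))
     (\<lambda>(x, \<xi>, \<eta>). (g x * A \<xi> * B \<eta>) *\<^sub>R u (x, \<xi> * x + \<eta>))"

lemma pairing_continuous:
  assumes [continuous_intros]: "continuous_on UNIV g" "continuous_on UNIV A" "continuous_on UNIV B"
  shows "continuous_on S (\<lambda>(x, \<xi>, \<eta>). (g x * A \<xi> * B \<eta>) *\<^sub>R u (x, \<xi> * x + \<eta>))"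
  unfolding split_beta'
  by (intro continuous_intros continuous_on_compose2[OF assms(1)]
    continuous_on_compose2[OF assms(2)] continuous_on_compose2[OF assms(3)]) auto

lemma shear_slice:
  assumes \<xi>: "\<bar>\<xi>\<bar> \<le> 1/4" and x: "\<bar>x\<bar> \<le> 1/2"
    and B: "\<And>\<eta>. \<eta> \<ge> 1/16 \<Longrightarrow> B \<eta> = 0" "continuous_on UNIV B"
  shows "integral {-1/16..1/16} (\<lambda>\<eta>. B \<eta> *\<^sub>R u (x, \<xi> * x + \<eta>))
       = integral {-2..2} (\<lambda>y. B (y - \<xi> * x) *\<^sub>R u (x, y))"
proof -
  let ?f = "\<lambda>\<eta>. B \<eta> *\<^sub>R u (x, \<xi> * x + \<eta>)"
  have "\<bar>\<xi> * x\<bar> \<le> 1/4 * (1/2)" unfolding abs_mult using assms by (intro mult_mono) auto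
  then have sub: "{-1/16..1/16} \<subseteq> {-2 - \<xi> * x..2 - \<xi> * x}" by auto
  have cont: "continuous_on {-1/16..1/16} ?f"
    by (intro continuous_intros continuous_on_subset[OF B(2)]) auto
  have "(?f has_integral integral {-1/16..1/16} ?f) {-1/16..1/16}"
    using integrable_continuous_real[OF cont] by (rule integrable_integral)
  then have "(?f has_integral integral {-1/16..1/16} ?f) {-2 - \<xi> * x..2 - \<xi> * x}"
  proof (rule has_integral_on_superset[OF _ _ sub])
    fix \<eta> :: real assume "\<eta> \<notin> {-1/16..1/16}"
    then consider "\<eta> \<le> -1/16" | "\<eta> \<ge> 1/16" by fastforce
    then show "?f \<eta> = 0" using B(1) vanishes_low[OF \<xi>] by cases auto
  qed
  from has_integral_shift_real_ivl[OF this, of "- \<xi> * x"]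
  have "((\<lambda>y. B (y - \<xi> * x) *\<^sub>R u (x, y)) has_integral integral {-1/16..1/16} ?f) {-2..2}"
    by simp
  then show ?thesis by (simp add: integral_unique)
qed

text \<open>
  The substitution \<open>y = \<xi> * x + \<eta>\<close> moves all dependence on the slope from \<open>u\<close>, which is only
  continuous, to the weight \<open>B (y - \<xi> * x)\<close>, which can be differentiated.
\<close>
lemma pairing_sheared:
  assumes g: "continuous_on UNIV g" and A: "continuous_on UNIV A" and B: "continuous_on UNIV B"
    and B0: "\<And>\<eta>. \<eta> \<ge> 1/16 \<Longrightarrow> B \<eta> = 0"
  shows "pairing g A B = integral {-1/2..1/2} (\<lambda>x. integral {-2..2} (\<lambda>y.
           (g x * integral {-1/4..1/4} (\<lambda>\<xi>. A \<xi> * B (y - \<xi> * x))) *\<^sub>R u (x, y)))"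
proof -
  note c [continuous_intros] = continuous_on_compose2[OF g] continuous_on_compose2[OF A]
    continuous_on_compose2[OF B]
  let ?k = "\<lambda>x \<xi> \<eta>. (g x * A \<xi> * B \<eta>) *\<^sub>R u (x, \<xi> * x + \<eta>)"
  have "pairing g A B = integral {-1/2..1/2} (\<lambda>x. integral (cbox (-1/4,-1/16) (1/4,1/16)) (\<lambda>(\<xi>, \<eta>). ?k x \<xi> \<eta>))"
    unfolding pairing_def by (subst integral_prod_continuous) (auto intro!: pairing_continuous g A B)
  also have "\<dots> = integral {-1/2..1/2} (\<lambda>x. integral {-1/4..1/4} (\<lambda>\<xi>. integral {-1/16..1/16} (\<lambda>\<eta>. ?k x \<xi> \<eta>)))"
    by (subst integral_prod_continuous) (auto simp: split_beta' intro!: continuous_intros)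
  also have "\<dots> = integral {-1/2..1/2} (\<lambda>x. integral {-1/4..1/4} (\<lambda>\<xi>. integral {-2..2}
      (\<lambda>y. (g x * A \<xi> * B (y - \<xi> * x)) *\<^sub>R u (x, y))))"
  proof (intro integral_cong)
    fix x \<xi> :: real assume "x \<in> {-1/2..1/2}" "\<xi> \<in> {-1/4..1/4}"
    then have "integral {-1/16..1/16} (\<lambda>\<eta>. B \<eta> *\<^sub>R u (x, \<xi> * x + \<eta>))
       = integral {-2..2} (\<lambda>y. B (y - \<xi> * x) *\<^sub>R u (x, y))"
      by (intro shear_slice B B0) auto
    then show "integral {-1/16..1/16} (?k x \<xi>) =
      integral {-2..2} (\<lambda>y. (g x * A \<xi> * B (y - \<xi> * x)) *\<^sub>R u (x, y))"
      by (simp only: scaleR_scaleR[symmetric, of "g x * A \<xi>"] integral_cmul)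
  qed
  also have "\<dots> = integral {-1/2..1/2} (\<lambda>x. integral {-2..2} (\<lambda>y. integral {-1/4..1/4}
      (\<lambda>\<xi>. (g x * A \<xi> * B (y - \<xi> * x)) *\<^sub>R u (x, y))))"
  proof (intro integral_cong)
    fix x :: real
    show "integral {-1/4..1/4} (\<lambda>\<xi>. integral {-2..2} (\<lambda>y. (g x * A \<xi> * B (y - \<xi> * x)) *\<^sub>R u (x, y)))
      = integral {-2..2} (\<lambda>y. integral {-1/4..1/4} (\<lambda>\<xi>. (g x * A \<xi> * B (y - \<xi> * x)) *\<^sub>R u (x, y)))"
      unfolding cbox_interval[symmetric]
      by (rule integral_swap_continuous) (auto simp: split_beta' intro!: continuous_intros)
  qed
  also have "\<dots> = integral {-1/2..1/2} (\<lambda>x. integral {-2..2} (\<lambda>y.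
           (g x * integral {-1/4..1/4} (\<lambda>\<xi>. A \<xi> * B (y - \<xi> * x))) *\<^sub>R u (x, y)))"
  proof (intro integral_cong)
    fix x y :: real
    have "(\<lambda>\<xi>. A \<xi> * B (y - \<xi> * x)) integrable_on {-1/4..1/4}"
      by (intro integrable_continuous_real continuous_intros) auto
    then have "((\<lambda>\<xi>. (g x * (A \<xi> * B (y - \<xi> * x))) *\<^sub>R u (x, y)) has_integral
      (g x * integral {-1/4..1/4} (\<lambda>\<xi>. A \<xi> * B (y - \<xi> * x))) *\<^sub>R u (x, y)) {-1/4..1/4}"
      by (intro has_integral_scaleR_left has_integral_mult_right integrable_integral)
    then show "integral {-1/4..1/4} (\<lambda>\<xi>. (g x * A \<xi> * B (y - \<xi> * x)) *\<^sub>R u (x, y))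
      = (g x * integral {-1/4..1/4} (\<lambda>\<xi>. A \<xi> * B (y - \<xi> * x))) *\<^sub>R u (x, y)"
      by (simp add: integral_unique mult.assoc)
  qed
  finally show ?thesis .
qed

text \<open>
  The formal identity behind this is \<open>x * \<partial>/\<partial>\<eta> = \<partial>/\<partial>\<xi>\<close> on functions of \<open>\<xi> * x + \<eta>\<close>: a factor \<open>x\<close> can be
  traded for a derivative in the slope and a primitive in the intercept. After the shear both
  operations act on weights, and the identity is one integration by parts in \<open>\<xi>\<close>.
\<close>
lemma pairing_times_x:
  assumes g: "continuous_on UNIV g" and A: "continuous_on UNIV A" and A': "continuous_on UNIV A'"
    and der: "\<And>\<xi>. (A has_real_derivative A' \<xi>) (at \<xi>)" and ends: "A (-1/4) = 0" "A (1/4) = 0"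
    and s: "s > 0"
  shows "pairing (\<lambda>x. x * g x) A (tent s j) = - pairing g A' (tent s (Suc j))"
proof -
  have eq: "integral {-1/4..1/4} (\<lambda>\<xi>. A' \<xi> * tent s (Suc j) (y - \<xi> * x))
     = - (x * integral {-1/4..1/4} (\<lambda>\<xi>. A \<xi> * tent s j (y - \<xi> * x)))" for x y
  proof -
    have "((\<lambda>\<xi>. A' \<xi> * tent s (Suc j) (y - \<xi> * x) + A \<xi> * (x * tent s j (y - \<xi> * x))) has_integral
       A (1/4) * tent s (Suc j) (y - 1/4 * x) - A (-1/4) * tent s (Suc j) (y - (-1/4) * x)) {-1/4..1/4}"
    proof (rule fundamental_theorem_of_calculus)
      fix \<xi> :: real
      have l: "((\<lambda>\<xi>. y - \<xi> * x) has_real_derivative - x) (at \<xi>)"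
        by (rule derivative_eq_intros refl | simp)+
      have "((\<lambda>\<xi>. A \<xi> * tent s (Suc j) (y - \<xi> * x)) has_real_derivative
         A' \<xi> * tent s (Suc j) (y - \<xi> * x) + A \<xi> * (x * tent s j (y - \<xi> * x))) (at \<xi>)"
        using DERIV_mult[OF der[of \<xi>] DERIV_tent[OF l, of s j]] by (simp add: algebra_simps)
      then show "((\<lambda>\<xi>. A \<xi> * tent s (Suc j) (y - \<xi> * x)) has_vector_derivative
         A' \<xi> * tent s (Suc j) (y - \<xi> * x) + A \<xi> * (x * tent s j (y - \<xi> * x))) (at \<xi> within {-1/4..1/4})"
        by (simp add: has_real_derivative_iff_has_vector_derivative[symmetric] has_field_derivative_at_within)
    qed simp
    then have 0: "integral {-1/4..1/4} (\<lambda>\<xi>. A' \<xi> * tent s (Suc j) (y - \<xi> * x) + A \<xi> * (x * tent s j (y - \<xi> * x))) = 0"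
      using ends by (simp add: integral_unique)
    have "(\<lambda>\<xi>. A' \<xi> * tent s (Suc j) (y - \<xi> * x)) integrable_on {-1/4..1/4}"
      "(\<lambda>\<xi>. A \<xi> * (x * tent s j (y - \<xi> * x))) integrable_on {-1/4..1/4}"
      by (intro integrable_continuous_real continuous_intros continuous_on_subset[OF A]
         continuous_on_subset[OF A'] subset_UNIV)+
    from integral_add[OF this] 0
    have "integral {-1/4..1/4} (\<lambda>\<xi>. A' \<xi> * tent s (Suc j) (y - \<xi> * x)) = 
      - integral {-1/4..1/4} (\<lambda>\<xi>. x * (A \<xi> * tent s j (y - \<xi> * x)))"
      by (simp add: mult.left_commute)
    then show ?thesis by simp
  qed
  have L: "pairing (\<lambda>x. x * g x) A (tent s j) = integral {-1/2..1/2} (\<lambda>x. integral {-2..2} (\<lambda>y.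
           (x * g x * integral {-1/4..1/4} (\<lambda>\<xi>. A \<xi> * tent s j (y - \<xi> * x))) *\<^sub>R u (x, y)))"
    by (intro pairing_sheared continuous_intros g A) (use s tent_eq_0 in auto)
  have R: "pairing g A' (tent s (Suc j)) = integral {-1/2..1/2} (\<lambda>x. integral {-2..2} (\<lambda>y.
           (g x * - (x * integral {-1/4..1/4} (\<lambda>\<xi>. A \<xi> * tent s j (y - \<xi> * x)))) *\<^sub>R u (x, y)))"
    unfolding eq[symmetric]
    by (intro pairing_sheared continuous_intros g A') (use s tent_eq_0 in auto)
  have "pairing g A' (tent s (Suc j)) = integral {-1/2..1/2} (\<lambda>x. - integral {-2..2} (\<lambda>y.
           (x * g x * integral {-1/4..1/4} (\<lambda>\<xi>. A \<xi> * tent s j (y - \<xi> * x))) *\<^sub>R u (x, y)))"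
    unfolding R integral_neg[symmetric] by (intro integral_cong) (simp add: mult_ac)
  then show ?thesis unfolding L by (simp add: integral_neg)
qed

lemma pairing_has_integral:
  assumes "continuous_on UNIV g" "continuous_on UNIV A" "continuous_on UNIV B"
  shows "((\<lambda>(x, \<xi>, \<eta>). (g x * A \<xi> * B \<eta>) *\<^sub>R u (x, \<xi> * x + \<eta>)) has_integral pairing g A B)
    (cbox (-1/2, -1/4, -1/16) (1/2, 1/4, 1/16))"
  unfolding pairing_def by (intro integrable_integral integrable_continuous pairing_continuous assms)

lemma pairing_linear_A:
  assumes g: "continuous_on UNIV g" and A: "continuous_on UNIV A\<^sub>1" "continuous_on UNIV A\<^sub>2"
    and B: "continuous_on UNIV B"
  shows "pairing g (\<lambda>\<xi>. a * A\<^sub>1 \<xi> + b * A\<^sub>2 \<xi>) B = a *\<^sub>R pairing g A\<^sub>1 B + b *\<^sub>R pairing g A\<^sub>2 B"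
  unfolding pairing_def[of g "\<lambda>\<xi>. a * A\<^sub>1 \<xi> + b * A\<^sub>2 \<xi>"]
  by (rule integral_unique, rule has_integral_eq[rotated],
      rule has_integral_add[OF has_integral_cmul has_integral_cmul, OF pairing_has_integral pairing_has_integral])
    (use assms in \<open>auto simp: distrib_left distrib_right scaleR_add_left mult_ac\<close>)

lemma pairing_linear_g:
  assumes g: "continuous_on UNIV g\<^sub>1" "continuous_on UNIV g\<^sub>2" "continuous_on UNIV g\<^sub>3"
    and A: "continuous_on UNIV A" and B: "continuous_on UNIV B"
  shows "pairing (\<lambda>x. a * g\<^sub>1 x + b * g\<^sub>2 x + d * g\<^sub>3 x) A B
       = a *\<^sub>R pairing g\<^sub>1 A B + b *\<^sub>R pairing g\<^sub>2 A B + d *\<^sub>R pairing g\<^sub>3 A B"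
  unfolding pairing_def[of "\<lambda>x. a * g\<^sub>1 x + b * g\<^sub>2 x + d * g\<^sub>3 x"]
  by (rule integral_unique, rule has_integral_eq[rotated],
      rule has_integral_add[OF has_integral_add[OF has_integral_cmul has_integral_cmul] has_integral_cmul,
        OF pairing_has_integral pairing_has_integral pairing_has_integral])
    (use assms in \<open>auto simp: distrib_left distrib_right scaleR_add_left mult_ac\<close>)

section \<open>Control of the pairing by the data\<close>

lemma radon_measurable: "radon u \<in> borel_measurable borel"
proof -
  have "continuous_on UNIV (\<lambda>q::(real \<times> real) \<times> real. u (snd q, fst (fst q) * snd q + snd (fst q)))"
    by (intro continuous_intros)
  then have "(\<lambda>(p, x). u (x, fst p * x + snd p)) \<in> borel_measurable (borel \<Otimes>\<^sub>M lborel)"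
    by (subst measurable_cong_sets[OF sets_pair_measure_cong[OF refl sets_lborel] refl])
      (simp add: borel_prod split_beta' borel_measurable_continuous_onI)
  then have "(\<lambda>p. LINT x|lborel. u (x, fst p * x + snd p)) \<in> borel_measurable borel"
    by (rule lborel.borel_measurable_lebesgue_integral)
  then show ?thesis by (simp add: radon_def split_beta')
qed

lemma radon_eq_integral:
  assumes "\<bar>\<xi>\<bar> \<le> 1/4" "\<eta> \<le> 1/16"
  shows "radon u (\<xi>, \<eta>) = integral {-1/2..1/2} (\<lambda>x. u (x, \<xi> * x + \<eta>))"
proof -
  have "set_integrable lborel {-1/2..1/2} (\<lambda>x. u (x, \<xi> * x + \<eta>))"
    by (intro borel_integrable_compact[folded set_integrable_def] continuous_intros) auto
  from set_borel_integral_eq_integral(2)[OF this]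
  have "integral {-1/2..1/2} (\<lambda>x. u (x, \<xi> * x + \<eta>))
      = (LINT x|lborel. indicator {-1/2..1/2} x *\<^sub>R u (x, \<xi> * x + \<eta>))"
    by (simp add: set_lebesgue_integral_def)
  also have "\<dots> = (LINT x|lborel. u (x, \<xi> * x + \<eta>))"
    using vanishes_wide[OF assms] by (intro Bochner_Integration.integral_cong) (auto simp: indicator_def abs_if)
  finally show ?thesis by (simp add: radon_def)
qed

text \<open>
  Integrating over \<open>x\<close> innermost leaves the Radon transform against \<open>A\<close> and \<open>B\<close>. The closed box
  exceeds the data rectangle only in the edges \<open>\<eta> = \<plusminus>1/16\<close>, where the weight or the transform is zero.
\<close>
lemma pairing_one_bound:
  assumes A: "continuous_on UNIV A" and B: "continuous_on UNIV B"
    and A1: "\<And>\<xi>. \<xi> \<in> {-1/4..1/4} \<Longrightarrow> \<bar>A \<xi>\<bar> \<le> 1"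
    and B2: "\<And>\<eta>. \<eta> \<ge> -1/16 \<Longrightarrow> \<bar>B \<eta>\<bar> \<le> 2" and B0: "\<And>\<eta>. \<eta> \<ge> 1/16 \<Longrightarrow> B \<eta> = 0"
    and m: "(\<integral>\<^sup>+p\<in>data_rect (1/4) (1/16). ennreal (norm (radon u p)) \<partial>lborel) \<le> ennreal m" "m \<ge> 0"
  shows "norm (pairing (\<lambda>_. 1) A B) \<le> 2 * m"
proof -
  let ?R = "cbox (-1/4, -1/16) (1/4, 1/16) :: (real \<times> real) set"
  let ?f = "\<lambda>p. (A (fst p) * B (snd p)) *\<^sub>R radon u p"
  note c [continuous_intros] = continuous_on_compose2[OF A] continuous_on_compose2[OF B]
  have rad: "radon u p = integral {-1/2..1/2} (\<lambda>x. u (x, fst p * x + snd p))" if "p \<in> ?R" for p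
    using that radon_eq_integral[of "fst p" "snd p"] by (cases p) (auto simp: abs_le_iff)
  have contr: "continuous_on ?R (\<lambda>p. integral (cbox (-1/2) (1/2)) (\<lambda>x. u (x, fst p * x + snd p)))"
    by (intro integral_continuous_on_param) (auto simp: split_beta' intro!: continuous_intros)
  have cont: "continuous_on ?R ?f"
    by (subst continuous_on_cong[OF refl, of _ _
        "\<lambda>p. (A (fst p) * B (snd p)) *\<^sub>R integral (cbox (-1/2) (1/2)) (\<lambda>x. u (x, fst p * x + snd p))"])
      (auto simp: rad intro!: continuous_intros contr[simplified])
  have "pairing (\<lambda>_. 1) A B = integral (cbox (-1/2) (1/2)) (\<lambda>x. integral ?R
      (\<lambda>p. (A (fst p) * B (snd p)) *\<^sub>R u (x, fst p * x + snd p)))"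
    unfolding pairing_def
    by (subst integral_prod_continuous)
      (auto intro!: pairing_continuous A B continuous_intros simp: split_beta')
  also have "\<dots> = integral ?R (\<lambda>p. integral (cbox (-1/2) (1/2))
      (\<lambda>x. (A (fst p) * B (snd p)) *\<^sub>R u (x, fst p * x + snd p)))"
    by (rule integral_swap_continuous) (auto simp: split_beta' intro!: continuous_intros)
  also have "\<dots> = integral ?R ?f"
    by (intro integral_cong) (simp add: rad)
  also have "\<dots> = (LINT p|lborel. indicator ?R p *\<^sub>R ?f p)"
    using set_borel_integral_eq_integral(2)[OF borel_integrable_compact[folded set_integrable_def, OF compact_cbox cont]]
    by (simp add: set_lebesgue_integral_def)
  finally have eq: "pairing (\<lambda>_. 1) A B = (LINT p|lborel. indicator ?R p *\<^sub>R ?f p)" .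
  have "ennreal (norm (pairing (\<lambda>_. 1) A B)) \<le> (\<integral>\<^sup>+p. norm (indicator ?R p *\<^sub>R ?f p) \<partial>lborel)"
    unfolding eq by (intro integral_norm_bound_ennreal borel_integrable_compact compact_cbox cont)
  also have "\<dots> \<le> (\<integral>\<^sup>+p. 2 * (ennreal (norm (radon u p)) * indicator (data_rect (1/4) (1/16)) p) \<partial>lborel)"
  proof (intro nn_integral_mono)
    fix p :: "real \<times> real"
    obtain \<xi> \<eta> where p: "p = (\<xi>, \<eta>)" by (cases p)
    have "p \<in> data_rect (1/4) (1/16)" if "p \<in> ?R" "\<eta> \<noteq> 1/16" "\<eta> \<noteq> -1/16"
      using that p by (auto simp: data_rect_def abs_if)
    then consider "p \<notin> ?R" | "p \<in> ?R" "\<eta> = 1/16" | "p \<in> ?R" "\<eta> = -1/16" | "p \<in> ?R" "p \<in> data_rect (1/4) (1/16)"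
      by blast
    then show "ennreal (norm (indicator ?R p *\<^sub>R ?f p)) \<le>
      2 * (ennreal (norm (radon u p)) * indicator (data_rect (1/4) (1/16)) p)"
    proof cases
      case 3
      then have "radon u p = 0"
        using vanishes_low[of \<xi> \<eta>] by (subst rad) (auto simp: p)
      then show ?thesis by simp
    next
      case 4
      then have "\<bar>A \<xi>\<bar> * \<bar>B \<eta>\<bar> \<le> 1 * 2"
        by (intro mult_mono A1 B2) (auto simp: p)
      then have "norm (indicator ?R p *\<^sub>R ?f p) \<le> 2 * norm (radon u p)"
        using 4 by (auto simp: p abs_mult intro!: mult_right_mono)
      then have "ennreal (norm (indicator ?R p *\<^sub>R ?f p)) \<le> ennreal (2 * norm (radon u p))"
        by (rule ennreal_leI)
      then show ?thesis using 4 by (simp add: ennreal_mult)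
    qed (auto simp: p B0)
  qed
  also have "\<dots> = 2 * (\<integral>\<^sup>+p\<in>data_rect (1/4) (1/16). ennreal (norm (radon u p)) \<partial>lborel)"
  proof (rule nn_integral_cmult)
    have "data_rect (1/4) (1/16) = {-1/4..1/4} \<times> {-1/16<..<1/16}"
      by (auto simp: data_rect_def)
    then have "data_rect (1/4) (1/16) \<in> sets borel" by (auto intro!: borel_Times)
    then show "(\<lambda>p. ennreal (norm (radon u p)) * indicator (data_rect (1/4) (1/16)) p) \<in> borel_measurable lborel"
      using radon_measurable by simp
  qed
  also have "\<dots> \<le> 2 * ennreal m" by (intro mult_left_mono m) auto
  also have "\<dots> = ennreal (2 * m)" using m by (simp add: ennreal_mult)
  finally show ?thesis using m by (simp add: ennreal_le_iff)
qed

text \<open>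
  Each factor \<open>x\<close> costs one derivative of the bump, that is a factor of at most \<open>2 * M\<close>, while the
  iterated primitives of the tent stay bounded. The exponents \<open>a\<close> and \<open>b\<close> limit the number of
  derivatives whose boundary terms vanish, hence the condition that both are at least \<open>k\<close>.
\<close>
lemma pairing_monomial_bound:
  assumes s: "s > 0"
    and m: "(\<integral>\<^sup>+p\<in>data_rect (1/4) (1/16). ennreal (norm (radon u p)) \<partial>lborel) \<le> ennreal m" "m \<ge> 0"
  shows "k \<le> a \<Longrightarrow> k \<le> b \<Longrightarrow> a \<le> M \<Longrightarrow> b \<le> M \<Longrightarrow>
    norm (pairing (\<lambda>x. x ^ k) (bump a b) (tent s j)) \<le> (2 * real M) ^ k * (2 * m)"
proof (induction k arbitrary: a b j)
  case 0
  have "norm (pairing (\<lambda>_. 1) (bump a b) (tent s j)) \<le> 2 * m"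
  proof (rule pairing_one_bound)
    show "\<bar>bump a b \<xi>\<bar> \<le> 1" if "\<xi> \<in> {-1/4..1/4}" for \<xi>
      using bump_bounds[OF that, of a b] by simp
  qed (use m tent_bound[OF s] tent_eq_0[OF s] in \<open>auto intro!: continuous_intros\<close>)
  then show ?case by simp
next
  case (Suc k)
  then obtain a' b' where ab: "a = Suc a'" "b = Suc b'" by (metis Suc_le_D)
  let ?A' = "\<lambda>\<xi>. - real a * bump a' b \<xi> + real b * bump a b' \<xi>"
  define p q where "p = pairing (\<lambda>x. x ^ k) (bump a' b) (tent s (Suc j))"
    and "q = pairing (\<lambda>x. x ^ k) (bump a b') (tent s (Suc j))"
  have "k \<le> a'" "k \<le> b'" "a' \<le> M" "b' \<le> M" "a \<le> M" "b \<le> M" "k \<le> a" "k \<le> b"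
    using Suc.prems ab by simp_all
  then have pq: "norm p \<le> (2 * real M) ^ k * (2 * m)" "norm q \<le> (2 * real M) ^ k * (2 * m)"
    unfolding p_def q_def by (blast intro: Suc.IH)+
  have "pairing (\<lambda>x. x ^ Suc k) (bump a b) (tent s j) = - pairing (\<lambda>x. x ^ k) ?A' (tent s (Suc j))"
    unfolding power_Suc
    by (rule pairing_times_x) (auto simp: ab s bump_ends
      intro!: continuous_intros DERIV_bump[THEN DERIV_cong])
  also have "\<dots> = - (- real a *\<^sub>R p + real b *\<^sub>R q)"
    unfolding p_def q_def by (subst pairing_linear_A) (auto intro!: continuous_intros)
  finally have "norm (pairing (\<lambda>x. x ^ Suc k) (bump a b) (tent s j)) = norm (- real a *\<^sub>R p + real b *\<^sub>R q)"
    by (simp only: norm_minus_cancel)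
  also have "\<dots> \<le> real a * norm p + real b * norm q"
    by (rule norm_triangle_le) simp
  also have "\<dots> \<le> real M * ((2 * real M) ^ k * (2 * m)) + real M * ((2 * real M) ^ k * (2 * m))"
    by (intro add_mono mult_mono pq) (use \<open>a \<le> M\<close> \<open>b \<le> M\<close> in auto)
  finally show ?case by (simp add: mult_ac)
qed

text \<open>
  Expanding one factor \<open>1 - (x - x\<^sub>0)\<^sup>2 = (1 - x\<^sub>0\<^sup>2) + 2 * x\<^sub>0 * x - x\<^sup>2\<close> at a time keeps the
  coefficients visible: their absolute values add up to less than \<open>4\<close>.
\<close>
lemma pairing_kernel_bound:
  assumes s: "s > 0" and x0: "\<bar>x\<^sub>0\<bar> \<le> 1/4"
    and m: "(\<integral>\<^sup>+p\<in>data_rect (1/4) (1/16). ennreal (norm (radon u p)) \<partial>lborel) \<le> ennreal m" "m \<ge> 0"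
    and M: "M > 0"
  shows "k + 2 * n \<le> M \<Longrightarrow>
    norm (pairing (\<lambda>x. x ^ k * (1 - (x - x\<^sub>0)\<^sup>2) ^ n) (bump M M) (tent s j))
      \<le> 4 ^ n * (2 * real M) ^ (k + 2 * n) * (2 * m)"
proof (induction n arbitrary: k)
  case 0
  then show ?case using pairing_monomial_bound[OF s m, of k M M M j] by simp
next
  case (Suc n)
  let ?P = "\<lambda>k. pairing (\<lambda>x. x ^ k * (1 - (x - x\<^sub>0)\<^sup>2) ^ n) (bump M M) (tent s j)"
  let ?E = "4 ^ n * (2 * real M) ^ (k + 2 * Suc n) * (2 * m)"
  have IH: "norm (?P i) \<le> ?E" if "i \<le> k + 2" for i
  proof -
    have "norm (?P i) \<le> 4 ^ n * (2 * real M) ^ (i + 2 * n) * (2 * m)"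
      using Suc.prems that by (intro Suc.IH) auto
    also have "\<dots> \<le> ?E"
      using that m M by (intro mult_mono power_increasing) auto
    finally show ?thesis .
  qed
  have "x ^ k * (1 - (x - x\<^sub>0)\<^sup>2) ^ Suc n = (1 - x\<^sub>0\<^sup>2) * (x ^ k * (1 - (x - x\<^sub>0)\<^sup>2) ^ n)
     + (2 * x\<^sub>0) * (x ^ (k + 1) * (1 - (x - x\<^sub>0)\<^sup>2) ^ n) + (-1) * (x ^ (k + 2) * (1 - (x - x\<^sub>0)\<^sup>2) ^ n)" for x
    by (simp add: power2_eq_square) algebra
  then have "pairing (\<lambda>x. x ^ k * (1 - (x - x\<^sub>0)\<^sup>2) ^ Suc n) (bump M M) (tent s j)
     = (1 - x\<^sub>0\<^sup>2) *\<^sub>R ?P k + (2 * x\<^sub>0) *\<^sub>R ?P (k + 1) + (-1) *\<^sub>R ?P (k + 2)"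
    by (simp only:) (intro pairing_linear_g continuous_intros)
  also have "norm \<dots> \<le> 1 * ?E + 1 * ?E + 1 * ?E"
  proof (intro norm_triangle_le add_mono order_trans[OF norm_triangle_ineq])
    have "x\<^sub>0\<^sup>2 \<le> 1" using x0 by (simp add: abs_square_le_1)
    then show "norm ((1 - x\<^sub>0\<^sup>2) *\<^sub>R ?P k) \<le> 1 * ?E"
      unfolding norm_scaleR by (intro mult_mono IH) auto
    show "norm ((2 * x\<^sub>0) *\<^sub>R ?P (k + 1)) \<le> 1 * ?E"
      unfolding norm_scaleR using x0 by (intro mult_mono IH) auto
    show "norm ((-1) *\<^sub>R ?P (k + 2)) \<le> 1 * ?E"
      unfolding norm_scaleR by (intro mult_mono IH) auto
  qed
  also have "\<dots> \<le> 4 * ?E" using m by simp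
  finally show ?case by (simp add: mult_ac)
qed

section \<open>Recovering point values\<close>

text \<open>
  The pairing is \<open>Z\<close> times an average of \<open>u\<close> with respect to a probability measure. Its spread in
  \<open>x\<close> and \<open>\<xi>\<close> is of order \<open>1 / sqrt n\<close> by the second moments of the Landau kernels, and that in \<open>\<eta>\<close>
  is at most \<open>1 / (8 * n)\<close>, so the average differs from \<open>u (x\<^sub>0, 1/16)\<close> by \<open>O (n powr (- \<alpha>/2))\<close>.
  The exponent \<open>2 * n\<close> of the bump is the degree of \<open>Q\<close>, as the bound on the pairing requires.
\<close>
lemma averaging:
  assumes holder: "\<And>p q. norm (u p - u q) \<le> C * norm (p - q) powr \<alpha>" and C: "C \<ge> 0"
    and \<alpha>: "0 < \<alpha>" "\<alpha> \<le> 1" and x0: "\<bar>x\<^sub>0\<bar> \<le> 1/4" and n: "n > 0"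
  defines "Q \<equiv> \<lambda>x. (1 - (x - x\<^sub>0)\<^sup>2) ^ n" and "A \<equiv> bump (2 * n) (2 * n)" and "B \<equiv> tent (1 / (8 * real n)) 0"
  defines "Z \<equiv> integral {-1/2..1/2} Q * integral {-1/4..1/4} A * integral {-1/16..1/16} B"
  shows "norm (u (x\<^sub>0, 1/16)) * Z \<le> norm (pairing Q A B) + 4 * C * real n powr (- \<alpha>/2) * Z"
proof -
  let ?box = "cbox (-1/2, -1/4, -1/16) (1/2, 1/4, 1/16) :: (real \<times> real \<times> real) set"
  let ?s = "1 / (8 * real n)"
  have s: "?s > 0" using n by simp
  have cont: "continuous_on S Q" "continuous_on S A" "continuous_on S B" for S
    unfolding Q_def A_def B_def by (intro continuous_intros)+
  have Q0: "Q x \<ge> 0" if "x \<in> {-1/2..1/2}" for x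
    unfolding Q_def using that x0 by (intro zero_le_power) (auto simp: abs_square_le_1)
  have A0: "A \<xi> \<ge> 0" if "\<xi> \<in> {-1/4..1/4}" for \<xi> unfolding A_def using that by (rule bump_bounds)
  have B0: "B \<eta> \<ge> 0" for \<eta> unfolding B_def by (rule tent_0_nonneg[OF s])
  define c where "c = C * real n powr (- \<alpha>/2)"
  have c: "c \<ge> 0" using C by (simp add: c_def)
  let ?K = "\<lambda>(x, \<xi>, \<eta>). Q x * A \<xi> * B \<eta>"
  let ?MQ = "integral {-1/2..1/2} (\<lambda>x. (x - x\<^sub>0)\<^sup>2 * Q x)" and ?MA = "integral {-1/4..1/4} (\<lambda>\<xi>. \<xi>\<^sup>2 * A \<xi>)"
  let ?ZQ = "integral {-1/2..1/2} Q" and ?ZA = "integral {-1/4..1/4} A" and ?ZB = "integral {-1/16..1/16} B"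
  have K: "(?K has_integral Z) ?box"
    unfolding Z_def by (intro integral_box_prod cont)
  have MQ: "((\<lambda>(x, \<xi>, \<eta>). (x - x\<^sub>0)\<^sup>2 * Q x * A \<xi> * B \<eta>) has_integral ?MQ * ?ZA * ?ZB) ?box"
    by (intro integral_box_prod cont continuous_intros)
  have MA: "((\<lambda>(x, \<xi>, \<eta>). Q x * (\<xi>\<^sup>2 * A \<xi>) * B \<eta>) has_integral ?ZQ * ?MA * ?ZB) ?box"
    by (intro integral_box_prod cont continuous_intros)
  \<comment> \<open>The majorant: the weight times \<open>3 + n * (x - x\<^sub>0)\<^sup>2 + n * \<xi>\<^sup>2\<close>, split into terms that factor.\<close>
  let ?F = "\<lambda>p. 3 * ?K p + real n * (case p of (x, \<xi>, \<eta>) \<Rightarrow> (x - x\<^sub>0)\<^sup>2 * Q x * A \<xi> * B \<eta>)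
        + real n * (case p of (x, \<xi>, \<eta>) \<Rightarrow> Q x * (\<xi>\<^sup>2 * A \<xi>) * B \<eta>)"
  have F: "((\<lambda>p. c * ?F p) has_integral
     c * (3 * Z + real n * (?MQ * ?ZA * ?ZB) + real n * (?ZQ * ?MA * ?ZB))) ?box"
    by (intro has_integral_mult_right has_integral_add K MQ MA)
  have D: "((\<lambda>p. ?K p *\<^sub>R u (x\<^sub>0, 1/16) - (case p of (x, \<xi>, \<eta>) \<Rightarrow> (Q x * A \<xi> * B \<eta>) *\<^sub>R u (x, \<xi> * x + \<eta>)))
      has_integral Z *\<^sub>R u (x\<^sub>0, 1/16) - pairing Q A B) ?box"
    by (intro has_integral_diff has_integral_scaleR_left K pairing_has_integral cont)
  have Znn: "?ZQ \<ge> 0" "?ZA \<ge> 0" "?ZB \<ge> 0"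
    by (intro integral_nonneg integrable_continuous_real cont; use Q0 A0 B0 in auto)+
  have "norm (Z *\<^sub>R u (x\<^sub>0, 1/16) - pairing Q A B)
     \<le> c * (3 * Z + real n * (?MQ * ?ZA * ?ZB) + real n * (?ZQ * ?MA * ?ZB))"
    unfolding integral_unique[OF D, symmetric] integral_unique[OF F, symmetric]
  proof (rule integral_norm_bound_integral)
    fix p assume p: "p \<in> ?box"
    obtain x \<xi> \<eta> where pe: "p = (x, \<xi>, \<eta>)" by (cases p)
    have r: "x \<in> {-1/2..1/2}" "\<xi> \<in> {-1/4..1/4}" "\<eta> \<in> {-1/16..1/16}" using p pe by auto
    have K0: "Q x * A \<xi> * B \<eta> \<ge> 0" using r Q0 A0 B0 by auto
    have "Q x * A \<xi> * B \<eta> * norm (u (x\<^sub>0, 1/16) - u (x, \<xi> * x + \<eta>))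
      \<le> Q x * A \<xi> * B \<eta> * (c * (3 + real n * (x - x\<^sub>0)\<^sup>2 + real n * \<xi>\<^sup>2))"
    proof (cases "\<eta> \<le> 1/16 - ?s")
      case True
      then have "B \<eta> = 0" unfolding B_def by (rule tent_0_eq_0[OF s])
      then show ?thesis by simp
    next
      case False
      let ?d = "norm ((x\<^sub>0, 1/16) - (x, \<xi> * x + \<eta>))"
      have "(1/16 - \<eta>)\<^sup>2 \<le> ?s\<^sup>2" using False r by (intro power_mono) auto
      also have "?s\<^sup>2 \<le> 1 / real n" using n by (simp add: field_simps power2_eq_square)
      finally have \<eta>: "(1/16 - \<eta>)\<^sup>2 \<le> 1 / real n" .
      have "\<bar>x\<bar> \<le> 1/2" using r by auto
      from power_mono[OF this, of 2] have "x\<^sup>2 \<le> 1/4" by (simp add: power_divide)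
      then have \<xi>x: "(\<xi> * x)\<^sup>2 \<le> \<xi>\<^sup>2 / 2"
        using mult_left_mono[of "x\<^sup>2" "1/4" "\<xi>\<^sup>2"] zero_le_power2[of \<xi>]
        unfolding power_mult_distrib by linarith
      have "?d\<^sup>2 = (x - x\<^sub>0)\<^sup>2 + (1/16 - \<eta> - \<xi> * x)\<^sup>2"
        by (simp add: norm_prod_def power2_commute algebra_simps)
      also have "\<dots> \<le> (x - x\<^sub>0)\<^sup>2 + (2 * (1/16 - \<eta>)\<^sup>2 + 2 * (\<xi> * x)\<^sup>2)"
      proof -
        have "(a - b)\<^sup>2 \<le> 2 * a\<^sup>2 + 2 * b\<^sup>2" for a b :: real
          using zero_le_power2[of "a + b"] by (simp add: power2_eq_square algebra_simps)
        then show ?thesis by (intro add_left_mono)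
      qed
      finally have "?d\<^sup>2 \<le> (x - x\<^sub>0)\<^sup>2 + \<xi>\<^sup>2 + 2 / real n" using \<eta> \<xi>x by simp
      then have "real n * ?d\<^sup>2 \<le> real n * ((x - x\<^sub>0)\<^sup>2 + \<xi>\<^sup>2 + 2 / real n)"
        by (rule mult_left_mono) simp
      also have "\<dots> = 2 + real n * (x - x\<^sub>0)\<^sup>2 + real n * \<xi>\<^sup>2" using n by (simp add: algebra_simps)
      finally have nd: "1 + real n * ?d\<^sup>2 \<le> 3 + real n * (x - x\<^sub>0)\<^sup>2 + real n * \<xi>\<^sup>2" by simp
      have "norm (u (x\<^sub>0, 1/16) - u (x, \<xi> * x + \<eta>)) \<le> C * ?d powr \<alpha>" by (rule holder)
      also have "\<dots> \<le> C * (real n powr (- \<alpha>/2) * (1 + real n * ?d\<^sup>2))"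
        by (intro mult_left_mono powr_le_rescaled_square n \<alpha> C) auto
      also have "\<dots> = c * (1 + real n * ?d\<^sup>2)" by (simp add: c_def)
      also have "\<dots> \<le> c * (3 + real n * (x - x\<^sub>0)\<^sup>2 + real n * \<xi>\<^sup>2)" by (rule mult_left_mono[OF nd c])
      finally show ?thesis by (rule mult_left_mono[OF _ K0])
    qed
    moreover have "c * ?F p = Q x * A \<xi> * B \<eta> * (c * (3 + real n * (x - x\<^sub>0)\<^sup>2 + real n * \<xi>\<^sup>2))"
      by (simp add: pe algebra_simps)
    moreover have "norm (?K p *\<^sub>R u (x\<^sub>0, 1/16) - (case p of (x, \<xi>, \<eta>) \<Rightarrow> (Q x * A \<xi> * B \<eta>) *\<^sub>R u (x, \<xi> * x + \<eta>)))
       = Q x * A \<xi> * B \<eta> * norm (u (x\<^sub>0, 1/16) - u (x, \<xi> * x + \<eta>))"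
      unfolding pe prod.case scaleR_diff_right[symmetric] norm_scaleR using K0 by simp
    ultimately show "norm (?K p *\<^sub>R u (x\<^sub>0, 1/16) - (case p of (x, \<xi>, \<eta>) \<Rightarrow> (Q x * A \<xi> * B \<eta>) *\<^sub>R u (x, \<xi> * x + \<eta>)))
      \<le> c * ?F p" by (simp only:)
  qed (use D F in \<open>auto simp: integrable_on_def\<close>)
  also have "\<dots> \<le> c * (4 * Z)"
  proof (rule mult_left_mono[OF _ c])
    have MQ0: "?MQ \<ge> 0" and MA0: "?MA \<ge> 0"
      by (intro integral_nonneg integrable_continuous_real continuous_intros cont;
        use Q0 A0 in auto)+
    have "(2 * real n + 3) * ?MQ \<le> ?ZQ"
      using landau_second_moment[of x\<^sub>0 1 "-1/2" "1/2" n] x0 by (auto simp: Q_def)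
    then have a: "real n * ?MQ \<le> ?ZQ / 2" using MQ0 by (simp add: distrib_right)
    have A_eq: "A = (\<lambda>\<xi>. ((1/4)\<^sup>2 - (\<xi> - 0)\<^sup>2) ^ (2 * n))"
      unfolding A_def bump_def[abs_def] power_mult_distrib[symmetric] by (simp add: power2_eq_square algebra_simps)
    have "(2 * real (2 * n) + 3) * ?MA \<le> (1/4)\<^sup>2 * ?ZA"
      using landau_second_moment[of 0 "1/4" "-1/4" "1/4" "2 * n"] unfolding A_eq by simp
    then have b: "real n * ?MA \<le> ?ZA / 2" using MA0 Znn(2) by (simp add: distrib_right power2_eq_square)
    have "real n * (?MQ * ?ZA * ?ZB) \<le> ?ZQ / 2 * (?ZA * ?ZB)"
      using mult_right_mono[OF a, of "?ZA * ?ZB"] Znn by (simp add: mult_ac)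
    moreover have "real n * (?ZQ * ?MA * ?ZB) \<le> ?ZA / 2 * (?ZQ * ?ZB)"
      using mult_right_mono[OF b, of "?ZQ * ?ZB"] Znn by (simp add: mult_ac)
    ultimately show "3 * Z + real n * (?MQ * ?ZA * ?ZB) + real n * (?ZQ * ?MA * ?ZB) \<le> 4 * Z"
      by (simp add: Z_def mult_ac)
  qed
  finally have "norm (Z *\<^sub>R u (x\<^sub>0, 1/16) - pairing Q A B) \<le> c * (4 * Z)" .
  moreover have "norm (Z *\<^sub>R u (x\<^sub>0, 1/16)) \<le> norm (Z *\<^sub>R u (x\<^sub>0, 1/16) - pairing Q A B) + norm (pairing Q A B)"
    using norm_triangle_ineq[of "Z *\<^sub>R u (x\<^sub>0, 1/16) - pairing Q A B" "pairing Q A B"] by simp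
  moreover have "Z \<ge> 0" unfolding Z_def using Znn by simp
  ultimately show ?thesis by (simp add: c_def mult_ac)
qed

text \<open>
  The bound on the pairing grows like \<open>(C * n) ^ (2 * n)\<close> and the total weight \<open>Z\<close> decays only
  exponentially, so dividing by \<open>Z\<close> changes nothing but the constant inside the power.
  For \<open>\<bar>x\<^sub>0\<bar> > 1/4\<close> the point \<open>(x\<^sub>0, 1/16)\<close> lies below the parabola.
\<close>
lemma point_bound:
  assumes holder: "\<And>p q. norm (u p - u q) \<le> C * norm (p - q) powr \<alpha>" and C: "C \<ge> 0"
    and \<alpha>: "0 < \<alpha>" "\<alpha> \<le> 1" and n: "n > 0"
    and m: "(\<integral>\<^sup>+p\<in>data_rect (1/4) (1/16). ennreal (norm (radon u p)) \<partial>lborel) \<le> ennreal m" "m \<ge> 0"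
  shows "norm (u (x\<^sub>0, 1/16)) \<le> 4096 * (400 * real n) ^ (2 * n) * m + 4 * C * real n powr (- \<alpha>/2)"
proof (cases "\<bar>x\<^sub>0\<bar> \<le> 1/4")
  case False
  then have "(1/4)\<^sup>2 < \<bar>x\<^sub>0\<bar>\<^sup>2" by (intro power_strict_mono) auto
  then have "u (x\<^sub>0, 1/16) = 0" by (intro support) (simp add: power2_eq_square)
  then show ?thesis using m C by simp
next
  case x0: True
  define Q where "Q = (\<lambda>x. (1 - (x - x\<^sub>0)\<^sup>2) ^ n)"
  define A where "A = bump (2 * n) (2 * n)"
  define B where "B = tent (1 / (8 * real n)) 0"
  define Z where "Z = integral {-1/2..1/2} Q * integral {-1/4..1/4} A * integral {-1/16..1/16} B"
  have ZQ: "1/2 * (15/16) ^ n \<le> integral {-1/2..1/2} Q"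
  proof -
    have "(x\<^sub>0 + 1/4 - (x\<^sub>0 - 1/4)) * (15/16) ^ n \<le> integral {-1/2..1/2} Q"
      unfolding Q_def
    proof (rule integral_ge_width)
      fix x assume "x \<in> {x\<^sub>0 - 1/4..x\<^sub>0 + 1/4}"
      then have "\<bar>x - x\<^sub>0\<bar> \<le> 1/4"
        unfolding atLeastAtMost_iff abs_le_iff by linarith
      from power_mono[OF this, of 2] have "(x - x\<^sub>0)\<^sup>2 \<le> 1/16" by (simp add: power_divide)
      then show "(1 - (x - x\<^sub>0)\<^sup>2) ^ n \<ge> (15/16) ^ n" by (intro power_mono) auto
    next
      fix x :: real assume "x \<in> {-1/2..1/2}"
      then show "0 \<le> (1 - (x - x\<^sub>0)\<^sup>2) ^ n"
        using x0 by (intro zero_le_power) (auto simp: abs_square_le_1)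
    qed (use x0 in \<open>auto intro!: continuous_intros\<close>)
    then show ?thesis by simp
  qed
  have ZA: "1/4 * (3/64) ^ (2 * n) \<le> integral {-1/4..1/4} A"
  proof -
    have "(1/8 - (-1/8)) * (3/64) ^ (2 * n) \<le> integral {-1/4..1/4} A"
      unfolding A_def
    proof (rule integral_ge_width)
      fix \<xi> :: real assume "\<xi> \<in> {-1/8..1/8}"
      then have "\<bar>\<xi>\<bar> \<le> 1/8" by auto
      from power_mono[OF this, of 2] have "\<xi>\<^sup>2 \<le> 1/64" by (simp add: power_divide)
      then have "3/64 \<le> (1/4 - \<xi>) * (1/4 + \<xi>)" by (simp add: power2_eq_square algebra_simps)
      then show "bump (2 * n) (2 * n) \<xi> \<ge> (3/64) ^ (2 * n)"
        unfolding bump_def power_mult_distrib[symmetric] by (intro power_mono) auto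
    qed (auto intro!: continuous_intros bump_bounds(1))
    then show ?thesis by simp
  qed
  have ZB: "integral {-1/16..1/16} B = 1 / (256 * (real n)\<^sup>2)"
    unfolding B_def using n by (subst integral_tent_0) (auto simp: power2_eq_square field_simps)
  \<comment> \<open>The base \<open>500\<close> exceeds the inverse of \<open>(15/16) * (3/64)\<^sup>2\<close>, and \<open>2048 = 2 * 4 * 256\<close>.\<close>
  have Z1: "1 \<le> 2048 * (real n)\<^sup>2 * 500 ^ n * Z"
  proof -
    have "(1::real) \<le> (500 * (15/16 * (3/64)\<^sup>2)) ^ n"
      by (rule one_le_power) (simp add: power2_eq_square)
    also have "\<dots> = 2048 * (real n)\<^sup>2 * 500 ^ n *
       ((1/2 * (15/16) ^ n) * (1/4 * (3/64) ^ (2 * n)) * (1 / (256 * (real n)\<^sup>2)))"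
    proof -
      have "2048 * N\<^sup>2 * F * ((1/2 * p) * (1/4 * q) * (1 / (256 * N\<^sup>2))) = F * (p * q)"
        if "N > 0" for N F p q :: real using that by (simp add: field_simps)
      then show ?thesis using n by (simp only: power_mult_distrib power_mult of_nat_0_less_iff)
    qed
    also have "\<dots> \<le> 2048 * (real n)\<^sup>2 * 500 ^ n * Z"
      unfolding Z_def ZB using order_trans[OF _ ZQ, of 0]
      by (intro mult_left_mono mult_right_mono mult_mono ZQ ZA) auto
    finally show ?thesis .
  qed
  have "Z > 0"
  proof (rule ccontr)
    assume "\<not> Z > 0"
    then have "2048 * (real n)\<^sup>2 * 500 ^ n * Z \<le> 0" by (intro mult_nonneg_nonpos) auto
    then show False using Z1 by linarith
  qed
  have "norm (pairing Q A B) \<le> 4 ^ n * (4 * real n) ^ (2 * n) * (2 * m)"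
    using pairing_kernel_bound[OF _ x0 m, of "1 / (8 * real n)" "2 * n" 0 n 0] n
    by (simp add: Q_def A_def B_def)
  also have "\<dots> \<le> \<dots> * (2048 * (real n)\<^sup>2 * 500 ^ n * Z)"
    using mult_left_mono[OF Z1, of "4 ^ n * (4 * real n) ^ (2 * n) * (2 * m)"] m by simp
  also have "\<dots> = 4096 * m * (4 ^ n * (4 * real n) ^ (2 * n) * 500 ^ n * (real n)\<^sup>2) * Z"
    by (simp add: mult_ac)
  also have "\<dots> \<le> 4096 * m * (400 * real n) ^ (2 * n) * Z"
  proof (intro mult_right_mono mult_left_mono)
    \<comment> \<open>The factor \<open>(real n)\<^sup>2 \<le> 4 ^ n\<close> joins the power: \<open>4 * 16 * 500 * 4 \<le> 400\<^sup>2\<close>.\<close>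
    have "real n \<le> 2 ^ n" using less_exp[of n] by (metis of_nat_le_iff of_nat_numeral of_nat_power less_imp_le)
    then have "(real n)\<^sup>2 \<le> (2 ^ n)\<^sup>2" by (intro power_mono) auto
    also have "\<dots> = 4 ^ n" by (simp add: power2_eq_square power_mult_distrib[symmetric])
    finally have "4 ^ n * (4 * real n) ^ (2 * n) * 500 ^ n * (real n)\<^sup>2
      \<le> 4 ^ n * (4 * real n) ^ (2 * n) * 500 ^ n * 4 ^ n" by (intro mult_left_mono) auto
    also have "\<dots> = (4 * (4 * real n)\<^sup>2 * 500 * 4) ^ n" by (simp only: power_mult power_mult_distrib)
    also have "\<dots> \<le> ((400 * real n)\<^sup>2) ^ n" by (intro power_mono) (auto simp: power_mult_distrib)
    finally show "4 ^ n * (4 * real n) ^ (2 * n) * 500 ^ n * (real n)\<^sup>2 \<le> (400 * real n) ^ (2 * n)"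
      by (simp add: power_mult)
  qed (use m \<open>Z > 0\<close> in auto)
  finally have "norm (u (x\<^sub>0, 1/16)) * Z \<le> 4096 * m * (400 * real n) ^ (2 * n) * Z + 4 * C * real n powr (- \<alpha>/2) * Z"
    using averaging[OF holder C \<alpha> x0 n] unfolding Q_def A_def B_def Z_def by linarith
  then have "norm (u (x\<^sub>0, 1/16)) * Z \<le> (4096 * m * (400 * real n) ^ (2 * n) + 4 * C * real n powr (- \<alpha>/2)) * Z"
    by (simp add: distrib_right)
  then show ?thesis using \<open>Z > 0\<close> by (simp add: mult_ac)
qed

end

section \<open>Optimising the degree\<close>

text \<open>
  With \<open>L = ln (1 / \<mu>)\<close> and \<open>\<beta> = 2 * \<rho> / \<alpha> < 1\<close> the choice \<open>n \<approx> L powr \<beta>\<close> makes the second term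
  equal to \<open>K * L powr (- \<rho>)\<close>. The logarithm of the first is \<open>O (L powr \<beta> * ln L) - L\<close>, where the
  last \<open>L\<close> wins; it is the strict inequality \<open>\<beta> < 1\<close> that absorbs the factor \<open>ln L\<close>.
\<close>
lemma log_rate:
  fixes B K \<alpha> \<rho> :: real
  assumes BK: "B \<ge> 0" "K \<ge> 0" and \<rho>: "0 < \<rho>" "2 * \<rho> < \<alpha>"
  obtains \<tau> where "0 < \<tau>" "\<tau> \<le> 1"
    "\<And>\<mu> v. 0 < \<mu> \<Longrightarrow> \<mu> < \<tau> \<Longrightarrow>
      (\<And>n. n > 0 \<Longrightarrow> v \<le> B * (400 * real n) ^ (2 * n) * \<mu> + K * real n powr (- \<alpha>/2)) \<Longrightarrow>
      v \<le> (B + K) / ln (1 / \<mu>) powr \<rho>"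
proof -
  define \<beta> where "\<beta> = 2 * \<rho> / \<alpha>"
  have \<beta>: "0 < \<beta>" "\<beta> < 1" and \<beta>\<alpha>: "\<beta> * (\<alpha>/2) = \<rho>" using \<rho> by (auto simp: \<beta>_def field_simps)
  have "eventually (\<lambda>L. 4 * L powr \<beta> * ln (800 * L powr \<beta>) + \<rho> * ln L \<le> L) at_top"
    using \<beta> by real_asymp
  then obtain L0 where L0: "\<And>L. L \<ge> L0 \<Longrightarrow> 4 * L powr \<beta> * ln (800 * L powr \<beta>) + \<rho> * ln L \<le> L"
    unfolding eventually_at_top_linorder by blast
  show ?thesis
  proof (rule that[of "exp (- max 1 L0)"])
    fix \<mu> v :: real
    assume \<mu>: "0 < \<mu>" "\<mu> < exp (- max 1 L0)"
      and v: "\<And>n. n > 0 \<Longrightarrow> v \<le> B * (400 * real n) ^ (2 * n) * \<mu> + K * real n powr (- \<alpha>/2)"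
    define L where "L = ln (1 / \<mu>)"
    have \<mu>L: "\<mu> = exp (- L)" using \<mu> by (simp add: L_def ln_div)
    then have L: "L \<ge> 1" "L \<ge> L0" using \<mu> by auto
    define n where "n = nat \<lceil>L powr \<beta>\<rceil>"
    have L\<beta>: "L powr \<beta> \<ge> 1" using L \<beta> by (intro ge_one_powr_ge_zero) auto
    have n: "real n \<ge> L powr \<beta>" "real n \<le> 2 * L powr \<beta>" unfolding n_def using L\<beta> by linarith+
    have n0: "n > 0" using n(1) L\<beta> by (cases n) auto
    have "real n powr (- \<alpha>/2) \<le> (L powr \<beta>) powr (- \<alpha>/2)"
      using n L\<beta> \<rho> by (intro powr_mono2') auto
    also have "\<dots> = L powr (- \<rho>)" using \<beta>\<alpha> by (simp add: powr_powr)
    finally have a: "real n powr (- \<alpha>/2) \<le> L powr (- \<rho>)" .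
    have "(400 * real n) ^ (2 * n) * \<mu> = exp (real (2 * n) * ln (400 * real n) - L)"
      using n0 by (simp only: exp_of_nat_mult exp_diff \<mu>L exp_minus) (simp add: field_simps)
    also have "\<dots> \<le> exp (- \<rho> * ln L)"
    proof -
      have "real (2 * n) * ln (400 * real n) \<le> (4 * L powr \<beta>) * ln (800 * L powr \<beta>)"
      proof (rule mult_mono)
        show "ln (400 * real n) \<le> ln (800 * L powr \<beta>)"
          by (rule ln_mono) (use n n0 in auto)
      qed (use n n0 L\<beta> in auto)
      then show ?thesis using L0[OF L(2)] by simp
    qed
    also have "\<dots> = L powr (- \<rho>)" using L by (simp add: powr_def)
    finally have b: "(400 * real n) ^ (2 * n) * \<mu> \<le> L powr (- \<rho>)" .
    have "v \<le> B * ((400 * real n) ^ (2 * n) * \<mu>) + K * real n powr (- \<alpha>/2)"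
      using v[OF n0] by (simp add: mult.assoc)
    also have "\<dots> \<le> B * L powr (- \<rho>) + K * L powr (- \<rho>)"
      by (intro add_mono mult_left_mono a b BK)
    also have "\<dots> = (B + K) / L powr \<rho>"
      by (simp add: powr_minus divide_inverse distrib_right)
    finally show "v \<le> (B + K) / ln (1 / \<mu>) powr \<rho>" by (simp add: L_def)
  qed auto
qed

section \<open>The stability estimate\<close>

lemma holder_pointwise:
  assumes "holder_seminorm \<alpha> u \<le> ennreal C" "C \<ge> 0"
  shows "norm (u p - u q) \<le> C * norm (p - q) powr \<alpha>"
proof (cases "p = q")
  case False
  have "ennreal (norm (u p - u q) / norm (p - q) powr \<alpha>) \<le> holder_seminorm \<alpha> u"
    unfolding holder_seminorm_def using False by (intro SUP_upper2[of "(p, q)"]) auto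
  also note assms(1)
  finally have "norm (u p - u q) / norm (p - q) powr \<alpha> \<le> C" using assms(2) by simp
  then show ?thesis using False by (simp add: divide_simps split: if_splits)
qed (use assms in simp)

lemma holder_continuous:
  fixes u :: "'a::real_normed_vector \<Rightarrow> 'b::real_normed_vector"
  assumes "\<And>p q. norm (u p - u q) \<le> C * norm (p - q) powr \<alpha>" "\<alpha> > 0"
  shows "continuous_on UNIV u"
  unfolding continuous_on_eq_continuous_at[OF open_UNIV] isCont_def
proof
  fix p :: 'a
  have "((\<lambda>q. u q - u p) \<longlongrightarrow> 0) (at p)"
  proof (rule Lim_null_comparison)
    show "\<forall>\<^sub>F q in at p. norm (u q - u p) \<le> C * norm (q - p) powr \<alpha>"
      using assms(1) by simp
    have "((\<lambda>q. norm (q - p)) \<longlongrightarrow> norm (p - p)) (at p)" by (intro tendsto_intros)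
    then have "((\<lambda>q. norm (q - p) powr \<alpha>) \<longlongrightarrow> 0) (at p)"
      using assms(2) by (intro tendsto_zero_powrI[of _ _ _ \<alpha>] tendsto_const) auto
    then show "((\<lambda>q. C * norm (q - p) powr \<alpha>) \<longlongrightarrow> 0) (at p)" by (rule tendsto_mult_right_zero)
  qed
  then show "(u \<longlongrightarrow> u p) (at p)" by (simp add: LIM_zero_iff)
qed

theorem corollary3p9:
  fixes \<alpha> \<rho> C\<^sub>0 c :: real
    and N :: "real \<Rightarrow> real \<Rightarrow> (real \<times> real \<Rightarrow> complex) \<Rightarrow> ennreal"
  assumes "data_norm_family N"
    and "1 / 2 < \<alpha>" and "\<alpha> \<le> 1"
    and "0 < \<rho>" and "\<rho> < \<alpha> - 1 / 2"
    and "0 < C\<^sub>0" and "1 < c"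
  shows "\<exists>\<epsilon>>0. \<exists>\<delta>>0. \<exists>C>0. \<exists>\<tau>>0. \<tau> \<le> 1 \<and>
    (\<forall>u :: real \<times> real \<Rightarrow> complex.
       holder_seminorm \<alpha> u \<le> ennreal C\<^sub>0 \<longrightarrow>
       closure {p. u p \<noteq> 0} \<subseteq> {(x, y). y \<ge> c * x\<^sup>2} \<longrightarrow>
       N \<epsilon> \<delta> (radon u) < ennreal \<tau> \<longrightarrow>
       (SUP x. ennreal (norm (u (x, \<delta>)))) \<le>
         ennreal (if N \<epsilon> \<delta> (radon u) = 0 then 0
                  else C / (ln (1 / enn2real (N \<epsilon> \<delta> (radon u)))) powr \<rho>))"
proof -
  let ?N = "\<lambda>u. N (1/4) (1/16) (radon u)"
  from assms(1) obtain c' :: real where c': "c' > 0" and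
    low: "\<And>g. g \<in> borel_measurable borel \<Longrightarrow> ennreal c' *
          max (\<integral>\<^sup>+p\<in>data_rect (1/4) (1/16). ennreal (norm (g p)) \<partial>lborel)
              (\<integral>\<^sup>+\<xi>\<in>{-(1/4)..1/4}. ennreal (norm (g (\<xi>, 1/16))) \<partial>lborel)
        \<le> N (1/4) (1/16) g"
    unfolding data_norm_family_def by (auto dest!: spec[of _ "1::real"])
  define B K where "B = 4096 / c'" and "K = 4 * C\<^sub>0"
  have BK: "B \<ge> 0" "K \<ge> 0" "B + K > 0" using c' assms(6) by (auto simp: B_def K_def intro!: add_pos_pos)
  obtain \<tau> where \<tau>: "0 < \<tau>" "\<tau> \<le> 1" and rate:
    "\<And>\<mu> v. 0 < \<mu> \<Longrightarrow> \<mu> < \<tau> \<Longrightarrow>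
      (\<And>n. n > 0 \<Longrightarrow> v \<le> B * (400 * real n) ^ (2 * n) * \<mu> + K * real n powr (- \<alpha>/2)) \<Longrightarrow>
      v \<le> (B + K) / ln (1 / \<mu>) powr \<rho>"
    by (rule log_rate[OF BK(1,2) assms(4), of \<alpha>]) (use assms(3,5) in linarith, blast)
  have main: "ennreal (norm (u (x, 1/16))) \<le>
      ennreal (if ?N u = 0 then 0 else (B + K) / (ln (1 / enn2real (?N u))) powr \<rho>)"
    if hol: "holder_seminorm \<alpha> u \<le> ennreal C\<^sub>0"
      and supp: "closure {p. u p \<noteq> 0} \<subseteq> {(x, y). y \<ge> c * x\<^sup>2}"
      and small: "?N u < ennreal \<tau>" for u x
  proof -
    have holder: "norm (u p - u q) \<le> C\<^sub>0 * norm (p - q) powr \<alpha>" for p q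
      using assms(6) by (intro holder_pointwise[OF hol]) simp
    interpret parabola_supported u
    proof
      show "continuous_on UNIV u" by (rule holder_continuous[OF holder]) (use assms in simp)
      fix x y :: real assume y: "y < x\<^sup>2"
      \<comment> \<open>For \<open>c > 1\<close> the region \<open>y \<ge> c * x\<^sup>2\<close> lies above the parabola \<open>y = x\<^sup>2\<close>.\<close>
      have "x\<^sup>2 \<le> c * x\<^sup>2" using assms(7) mult_right_mono[of 1 c "x\<^sup>2"] by simp
      then have "(x, y) \<notin> closure {p. u p \<noteq> 0}" using y supp by fastforce
      then show "u (x, y) = 0" using closure_subset[of "{p. u p \<noteq> 0}"] by auto
    qed
    define \<mu> where "\<mu> = enn2real (?N u)"
    have "?N u < top" using small by (rule order.strict_trans) simp
    then have N\<mu>: "?N u = ennreal \<mu>" unfolding \<mu>_def by simp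
    have \<mu>: "\<mu> \<ge> 0" "\<mu> < \<tau>" using small \<tau> unfolding N\<mu> by (auto simp: \<mu>_def ennreal_less_iff)
    let ?m = "\<integral>\<^sup>+p\<in>data_rect (1/4) (1/16). ennreal (norm (radon u p)) \<partial>lborel"
    have "?m = ennreal (1 / c') * (ennreal c' * ?m)"
      using c' by (simp add: mult.assoc[symmetric] ennreal_mult[symmetric])
    also have "\<dots> \<le> ennreal (1 / c') * ?N u"
      by (intro mult_left_mono order_trans[OF _ low] radon_measurable) auto
    also have "\<dots> = ennreal (\<mu> / c')" using c' \<mu> by (simp add: N\<mu> ennreal_mult[symmetric])
    finally have m: "?m \<le> ennreal (\<mu> / c')" .
    have bound: "norm (u (x, 1/16)) \<le> B * (400 * real n) ^ (2 * n) * \<mu> + K * real n powr (- \<alpha>/2)"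
      if "n > 0" for n
      using point_bound[OF holder _ _ _ that m, of x] assms \<mu> c' by (simp add: B_def K_def)
    show ?thesis
    proof (cases "\<mu> = 0")
      case True
      \<comment> \<open>Vanishing data leave no term that grows with \<open>n\<close>, so the degree can tend to infinity.\<close>
      have "(\<lambda>n. K * real n powr (- \<alpha>/2)) \<longlonglongrightarrow> 0" using assms by real_asymp
      moreover have "eventually (\<lambda>n. norm (u (x, 1/16)) \<le> K * real n powr (- \<alpha>/2)) sequentially"
        using eventually_gt_at_top[of 0] by eventually_elim (use bound True in simp)
      ultimately have "norm (u (x, 1/16)) \<le> 0" by (intro tendsto_lowerbound) auto
      then show ?thesis by simp
    next
      case False
      then have "norm (u (x, 1/16)) \<le> (B + K) / ln (1 / \<mu>) powr \<rho>"
        using \<mu> by (intro rate bound) auto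
      then show ?thesis using False \<mu> by (auto simp: N\<mu> intro!: ennreal_leI)
    qed
  qed
  show ?thesis
    by (rule exI[of _ "1/4"], rule conjI, simp, rule exI[of _ "1/16"], rule conjI, simp,
        rule exI[of _ "B + K"], rule conjI, rule BK(3), rule exI[of _ \<tau>])
      (use \<tau> main in \<open>blast intro: SUP_least\<close>)
qed

end
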